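(* Let $1\le m\le M-1$ be integers. Let $A_0,B_0\in\mathbb{R}^{M\times M}_{\rm sym}$ be commuting matrices with $A_0\succeq0$, and let $\epsilon\mapsto A^\epsilon=\sum_{n\ge0}\epsilon^nA_n$ and $\epsilon\mapsto B^\epsilon=\sum_{n\ge0}\epsilon^nB_n$ be $\mathbb{R}^{M\times M}_{\rm sym}$-valued functions, real-analytic in a neighborhood of $\epsilon=0$ in $\mathbb{R}$, with values $A_0$ and $B_0$ at $\epsilon=0$. For $P\in\mathcal M=\mathrm{Gr}(m,\mathbb{R}^M)$ let $$J^\epsilon(P):=\mathrm{Tr}(B^\epsilon P)-\tfrac12\mathrm{Tr}(A^\epsilon PA^\epsilon P).$$ Let $c_1^0\le\cdots\le c_M^0$ be the eigenvalues of $C_0:=B_0-\frac12A_0^2$ (counting multiplicities), and let $U_0\in O(M)$ be such that $A_0=U_0\,\mathrm{diag}(a_1^0,\dots,a_M^0)U_0^T$, $B_0=U_0\,\mathrm{diag}(b_1^0,\dots,b_M^0)U_0^T$ and $C_0=U_0\,\mathrm{diag}(c_1^0,\dots,c_M^0)U_0^T$, with $c_j^0=b_j^0-\frac12(a_j^0)^2$. Write in block form (blocks of sizes $m$ and $M-m$) $$A_1=U_0\begin{pmatrix} A_1^{\rm oo} & A_1^{\rm ov} \\ A_1^{\rm vo} & A_1^{\rm vv} \end{pmatrix}U_0^T,\qquad B_1=U_0\begin{pmatrix} B_1^{\rm oo} & B_1^{\rm ov} \\ B_1^{\rm vo} & B_1^{\rm vv} \end{pmatrix}U_0^T.$$ If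 $c_m^0<c_{m+1}^0$, then there exists $\epsilon_0>0$ such that for all $\epsilon\in(-\epsilon_0,\epsilon_0)$ the problem $\min_{P\in\mathcal M}J^\epsilon(P)$ has a unique global minimizer $P^\epsilon$, and the function $(-\epsilon_0,\epsilon_0)\ni\epsilon\mapsto P^\epsilon\in\mathbb{R}^{M\times M}_{\rm sym}$ is real-analytic. Moreover, for $|\epsilon|$ small enough, $P^\epsilon=\sum_{n=0}^{+\infty}\epsilon^nP_n$ with $$P_0=U_0\begin{pmatrix} I_m & 0 \\ 0 & 0 \end{pmatrix}U_0^T,\qquad P_1=U_0\begin{pmatrix} 0 & P_1^{\rm ov} \\ P_1^{\rm vo} & 0 \end{pmatrix}U_0^T,\qquad P_1^{\rm vo}=(P_1^{\rm ov})^T,$$ where for all $1\le i\le m$ and $1\le j\le M-m$, $$(P_1^{\rm ov})_{ij}=-\frac{(B_1^{\rm ov})_{ij}-a_i^0(A_1^{\rm ov})_{ij}}{c_{m+j}^0-c_i^0+\frac12(a_{m+j}^0-a_i^0)^2}.$$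
   Context: $\mathbb{R}^{M\times M}_{\rm sym}$ is the space of real symmetric $M\times M$ matrices; $\mathrm{Gr}(m,\mathbb{R}^M):=\{P\in\mathbb{R}^{M\times M}_{\rm sym} : P^2=P,\ \mathrm{Tr}(P)=m\}$ is the set of rank-$m$ orthogonal projectors; $O(M)$ is the orthogonal group. *)

theory Defs
  imports "HOL-Analysis.Analysis"
begin

definition real_analytic_on :: "real set \<Rightarrow> (real \<Rightarrow> 'a::real_normed_vector) \<Rightarrow> bool" where
  "real_analytic_on S f \<longleftrightarrow>
     (\<forall>x\<in>S. \<exists>a r. r > 0 \<and> (\<forall>y. \<bar>y - x\<bar> < r \<longrightarrow> (\<lambda>n. (y - x) ^ n *\<^sub>R a n) sums f y))"

definition sym_mat :: "real ^ 'n ^ 'n \<Rightarrow> bool" where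
  "sym_mat A \<longleftrightarrow> transpose A = A"

definition psd_mat :: "real ^ 'n::finite ^ 'n \<Rightarrow> bool" where
  "psd_mat A \<longleftrightarrow> sym_mat A \<and> (\<forall>x. 0 \<le> x \<bullet> (A *v x))"

definition Gr :: "nat \<Rightarrow> (real ^ 'n::finite ^ 'n) set" where
  "Gr m = {P. sym_mat P \<and> P ** P = P \<and> trace P = real m}"

definition J :: "real ^ 'n::finite ^ 'n \<Rightarrow> real ^ 'n ^ 'n \<Rightarrow> real ^ 'n ^ 'n \<Rightarrow> real" where
  "J A B P = trace (B ** P) - 1/2 * trace (A ** P ** A ** P)"

(* c 1, ..., c M are the roots of the characteristic polynomial of C, with multiplicity. *)
definition eigenvalues_with_mult :: "nat \<Rightarrow> real ^ 'n::finite ^ 'n \<Rightarrow> (nat \<Rightarrow> real) \<Rightarrow> bool" where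
  "eigenvalues_with_mult M C c \<longleftrightarrow> (\<forall>t. det (mat t - C) = (\<Prod>k=1..M. t - c k))"

(* Rows and columns of an M x M matrix are indexed by a finite type 'n; a bijection
   pos from 'n onto {1..M} numbers them. Scalar families and blocks are functions
   of natural numbers starting at 1. *)
definition diag_mat :: "('n \<Rightarrow> nat) \<Rightarrow> (nat \<Rightarrow> real) \<Rightarrow> real ^ 'n ^ 'n" where
  "diag_mat pos d = (\<chi> p q. if p = q then d (pos p) else 0)"

(* The block ul has size m x m; each block is numbered from 1 in both arguments. *)
definition block_mat :: "('n \<Rightarrow> nat) \<Rightarrow> nat \<Rightarrow> (nat \<Rightarrow> nat \<Rightarrow> real) \<Rightarrow> (nat \<Rightarrow> nat \<Rightarrow> real) \<Rightarrow>
    (nat \<Rightarrow> nat \<Rightarrow> real) \<Rightarrow> (nat \<Rightarrow> nat \<Rightarrow> real) \<Rightarrow> real ^ 'n ^ 'n" where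
  "block_mat pos m ul ur ll lr = (\<chi> p q.
     if pos p \<le> m
     then (if pos q \<le> m then ul (pos p) (pos q) else ur (pos p) (pos q - m))
     else (if pos q \<le> m then ll (pos p - m) (pos q) else lr (pos p - m) (pos q - m)))"

end

theory Submission
  imports Defs "HOL-Complex_Analysis.Cauchy_Integral_Formula"
begin

text \<open>After conjugation by \<open>U\<^sub>0\<close> the unperturbed matrices are diagonal. On projectors,
  \<open>J\<^sup>0(P) = Tr(C\<^sub>0 P) + 1/4 |[A\<^sub>0, P]|\<^sup>2\<close>, so the spectral gap makes \<open>P\<^sub>0\<close> a minimizer with quadratic growth,
  and every minimizer of a small perturbation is close to \<open>P\<^sub>0\<close>. A minimizer satisfies \<open>P\<^sup>2 = P\<close> and
  \<open>[B - APA, P] = 0\<close>. Near \<open>P\<^sub>0\<close> these two equations are rewritten as a fixed-point problem for a map which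
  is polynomial in \<open>(A, B, P - P\<^sub>0)\<close> and a contraction in \<open>P - P\<^sub>0\<close>. This gives uniqueness; letting \<open>\<epsilon>\<close> be
  complex, the fixed-point iterates are holomorphic and converge uniformly, so the minimizer is analytic.
  Differentiating the two equations at \<open>\<epsilon> = 0\<close> gives \<open>P\<^sub>1\<close>.\<close>

section \<open>Matrix products and contractions\<close>

text \<open>The two matrix equations have twice as many entries as the unknown, so an implicit
  function argument does not apply to the pair. The fixed-point map keeps the diagonal blocks of
  \<open>P\<^sup>2 = P\<close> and the off-diagonal blocks of the commutator: one equation per
  entry. This loses nothing, because the argument runs in one direction. A minimizer exists by
  compactness and satisfies both equations in full, hence it is the fixed point; that the fixed
  point is a projector is read off from the minimizer. Off the diagonal blocks the map is a
  simplified Newton step with denominators frozen at the unperturbed data. They equal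
  \<open>c j - c i + 1/2 * (a i - a j)\<^sup>2\<close>, positive by the gap, and are those of the
  formula for \<open>P\<^sub>1\<close>. Complex \<epsilon> enters because uniform limits of
  real-analytic functions need not be analytic, while uniform limits of holomorphic functions are
  holomorphic. The extension is available because the map uses sums, entrywise weights and matrix
  products only, with no transposition. The contraction radius is fixed first; quadratic growth then
  forces every minimizer into that ball.\<close>

lemma bounded_bilinear_matrix_mult:
  "bounded_bilinear (matrix_matrix_mult :: ('a::{real_algebra_1,euclidean_space})^'n^'m \<Rightarrow> 'a^'p^'n \<Rightarrow> 'a^'p^'m)"
  unfolding bilinear_conv_bounded_bilinear[symmetric] bilinear_def
  by (auto intro!: linearI simp: vec_eq_iff matrix_matrix_mult_def scaleR_sum_right
      distrib_left distrib_right sum.distrib)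

lemmas continuous_on_matrix_mult [continuous_intros] =
  bounded_bilinear.continuous_on[OF bounded_bilinear_matrix_mult]

lemmas has_derivative_matrix_mult [derivative_intros] =
  bounded_bilinear.FDERIV[OF bounded_bilinear_matrix_mult]

lemmas matrix_add_rdistrib = bounded_bilinear.add_left[OF bounded_bilinear_matrix_mult]
lemmas matrix_diff_ldistrib = bounded_bilinear.diff_right[OF bounded_bilinear_matrix_mult]
lemmas matrix_diff_rdistrib = bounded_bilinear.diff_left[OF bounded_bilinear_matrix_mult]

text \<open>Mean value inequality: a derivative that vanishes at \<open>(p0, 0)\<close> stays small
  on a product neighbourhood. The bounds 1/2 and \<open>r/2\<close> are matched so that
  \<open>T p\<close> maps the ball of radius \<open>r\<close> into itself.\<close>

lemma contraction_near_critical_fixpoint: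
  fixes T :: "'p::metric_space \<Rightarrow> 'v::euclidean_space \<Rightarrow> 'v"
  assumes der: "\<And>p x. (T p has_derivative T' p x) (at x)"
    and cont': "\<And>h. continuous_on UNIV (\<lambda>(p, x). T' p x h)"
    and crit: "\<And>h. T' p0 0 h = 0"
    and fix0: "T p0 0 = 0"
    and cont: "continuous_on UNIV (\<lambda>p. T p 0)"
  obtains r where "r > 0"
    "\<forall>\<^sub>F p in nhds p0. (\<forall>x\<in>cball 0 r. \<forall>y\<in>cball 0 r. norm (T p x - T p y) \<le> 1/2 * norm (x - y))
      \<and> norm (T p 0) \<le> r/2"
proof -
  \<comment> \<open>This sum over the basis dominates the operator norm, so continuity of
    \<open>T' p x h\<close> for each fixed \<open>h\<close> is enough.\<close>
  let ?D = "\<lambda>q. \<Sum>i\<in>Basis. norm (T' (fst q) (snd q) i)"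
  have "continuous_on UNIV ?D"
    using cont' by (auto intro!: continuous_intros simp: case_prod_beta)
  then have "isCont ?D (p0, 0)"
    by (simp add: continuous_on_eq_continuous_at)
  then have "((\<lambda>q. ?D q) \<longlongrightarrow> ?D (p0, 0)) (nhds (p0, 0))"
    using continuous_at_imp_continuous_at_within isContD tendsto_at_iff_tendsto_nhds by blast
  moreover have "?D (p0, 0) < 1/2"
    by (simp add: crit)
  ultimately have "\<forall>\<^sub>F q in nhds (p0, 0). ?D q < 1/2"
    by (rule order_tendstoD(2))
  then have "\<forall>\<^sub>F q in nhds p0 \<times>\<^sub>F nhds 0. ?D q < 1/2"
    by (simp add: nhds_prod)
  then obtain P1 P2 where P: "\<forall>\<^sub>F p in nhds p0. P1 p" "\<forall>\<^sub>F x in nhds 0. P2 x"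
    and D: "\<And>p x. P1 p \<Longrightarrow> P2 x \<Longrightarrow> ?D (p, x) < 1/2"
    unfolding eventually_prod_filter by blast
  obtain r where r: "r > 0" "\<And>x. x \<in> cball 0 r \<Longrightarrow> P2 x"
    using P(2) unfolding eventually_nhds_metric_le by (auto simp: dist_commute)
  have "((\<lambda>p. norm (T p 0)) \<longlongrightarrow> norm (T p0 0)) (nhds p0)"
    using cont by (intro tendsto_norm) (metis UNIV_I continuous_on_eq_continuous_at isContD
        open_UNIV tendsto_at_iff_tendsto_nhds)
  then have small: "\<forall>\<^sub>F p in nhds p0. norm (T p 0) < r/2"
    using r(1) fix0 by (intro order_tendstoD(2)) auto
  have lip: "norm (T p x - T p y) \<le> 1/2 * norm (x - y)"
    if "P1 p" "x \<in> cball 0 r" "y \<in> cball 0 r" for p x y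
  proof (rule differentiable_bound[of "cball 0 r"])
    show "(T p has_derivative T' p z) (at z within cball 0 r)" for z
      using der by (rule has_derivative_at_withinI)
    show "onorm (T' p z) \<le> 1/2" if "z \<in> cball 0 r" for z
      using D[OF \<open>P1 p\<close> r(2)[OF that]] has_derivative_bounded_linear[OF der]
      by (intro onorm_componentwise_le) auto
  qed (use that in auto)
  have "\<forall>\<^sub>F p in nhds p0.
      (\<forall>x\<in>cball 0 r. \<forall>y\<in>cball 0 r. norm (T p x - T p y) \<le> 1/2 * norm (x - y)) \<and> norm (T p 0) \<le> r/2"
    using P(1) small by eventually_elim (use lip in auto)
  with r(1) show thesis by (rule that)
qed

text \<open>The Picard iterates started at 0 are holomorphic by \<open>hol\<close>, and the
  contraction constant does not depend on the parameter, so they converge uniformly on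
  \<open>S\<close> and the limit is holomorphic.\<close>

lemma holomorphic_fixpoint:
  fixes T :: "complex \<Rightarrow> complex^'n^'m \<Rightarrow> complex^'n^'m"
  assumes S: "open S" and r: "r > 0"
    and contr: "\<And>z x y. z \<in> S \<Longrightarrow> x \<in> cball 0 r \<Longrightarrow> y \<in> cball 0 r \<Longrightarrow>
      norm (T z x - T z y) \<le> 1/2 * norm (x - y)"
    and small: "\<And>z. z \<in> S \<Longrightarrow> norm (T z 0) \<le> r/2"
    and hol: "\<And>f. (\<And>i j. (\<lambda>z. f z $ i $ j) holomorphic_on S) \<Longrightarrow>
      (\<And>i j. (\<lambda>z. T z (f z) $ i $ j) holomorphic_on S)"
  obtains f where "\<And>z. z \<in> S \<Longrightarrow> f z \<in> cball 0 r" "\<And>z. z \<in> S \<Longrightarrow> T z (f z) = f z"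
    "\<And>z x. z \<in> S \<Longrightarrow> x \<in> cball 0 r \<Longrightarrow> T z x = x \<Longrightarrow> x = f z"
    "\<And>i j. (\<lambda>z. f z $ i $ j) holomorphic_on S"
proof -
  have self: "T z x \<in> cball 0 r" if "z \<in> S" "x \<in> cball 0 r" for z x
  proof -
    have "norm (T z x) \<le> norm (T z x - T z 0) + norm (T z 0)"
      by (metis norm_triangle_sub add.commute)
    also have "\<dots> \<le> 1/2 * norm (x - 0) + r/2"
      using that r by (intro add_mono contr small) auto
    finally show ?thesis using that by simp
  qed
  have "\<exists>!x. x \<in> cball 0 r \<and> T z x = x" if "z \<in> S" for z
  proof -
    have "\<exists>!x\<in>cball 0 r. T z x = x"
      by (rule Banach_fix[where c="1/2"])
        (use self[OF that] contr[OF that] r in \<open>auto simp: dist_norm complete_eq_closed\<close>)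
    then show ?thesis .
  qed
  then obtain f where f: "\<And>z. z \<in> S \<Longrightarrow> f z \<in> cball 0 r" "\<And>z. z \<in> S \<Longrightarrow> T z (f z) = f z"
    "\<And>z x. z \<in> S \<Longrightarrow> x \<in> cball 0 r \<Longrightarrow> T z x = x \<Longrightarrow> x = f z"
    by metis
  define g where "g n z = (T z ^^ n) 0" for n z
  have g_hol: "(\<lambda>z. g n z $ i $ j) holomorphic_on S" for n i j
  proof (induction n arbitrary: i j)
    case 0
    then show ?case by (simp add: g_def)
  next
    case (Suc n)
    then show ?case using hol[OF Suc] by (simp add: g_def)
  qed
  \<comment> \<open>The first error is at most \<open>r\<close> and each step halves it; membership
    in the ball is carried along so that \<open>contr\<close> applies again.\<close>
  have g: "g n z \<in> cball 0 r \<and> norm (g n z - f z) \<le> r * (1/2)^n" if "z \<in> S" for n z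
  proof (induction n)
    case 0
    then show ?case using f(1)[OF that] r by (simp add: g_def)
  next
    case (Suc n)
    have "norm (T z (g n z) - T z (f z)) \<le> 1/2 * norm (g n z - f z)"
      using Suc that f by (intro contr) auto
    then show ?case using Suc self[OF that, of "g n z"] f(2)[OF that] by (simp add: g_def)
  qed
  have lim: "uniform_limit S (\<lambda>n z. g n z $ i $ j) (\<lambda>z. f z $ i $ j) sequentially" for i j
  proof (rule uniform_limitI)
    fix e :: real assume "e > 0"
    have "(\<lambda>n. r * (1/2)^n) \<longlonglongrightarrow> r * 0"
      by (intro tendsto_intros LIMSEQ_power_zero) auto
    then have "\<forall>\<^sub>F n in sequentially. r * (1/2)^n < e"
      using \<open>e > 0\<close> by (intro order_tendstoD(2)) auto
    then show "\<forall>\<^sub>F n in sequentially. \<forall>z\<in>S. dist (g n z $ i $ j) (f z $ i $ j) < e"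
    proof eventually_elim
      case (elim n)
      show ?case
      proof
        fix z assume "z \<in> S"
        have "dist (g n z $ i $ j) (f z $ i $ j) \<le> norm ((g n z - f z) $ i)"
          unfolding dist_norm by (metis Finite_Cartesian_Product.norm_nth_le vector_minus_component)
        also have "\<dots> \<le> norm (g n z - f z)"
          by (rule Finite_Cartesian_Product.norm_nth_le)
        finally show "dist (g n z $ i $ j) (f z $ i $ j) < e"
          using g[OF \<open>z \<in> S\<close>, of n] elim by linarith
      qed
    qed
  qed
  have "(\<lambda>z. f z $ i $ j) holomorphic_on S" for i j
  proof (rule holomorphic_uniform_sequence[OF S g_hol])
    fix x assume "x \<in> S"
    then obtain d where "d > 0" "cball x d \<subseteq> S"
      using S open_contains_cball by blast
    then show "\<exists>d>0. cball x d \<subseteq> S \<and> uniform_limit (cball x d) (\<lambda>n z. g n z $ i $ j) (\<lambda>z. f z $ i $ j) sequentially"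
      using uniform_limit_on_subset[OF lim] by blast
  qed
  with f that show thesis by blast
qed

section \<open>The functional on the Grassmannian\<close>

text \<open>Unlike \<open>diag_mat\<close>, this is indexed by the matrix index itself and takes any
  coefficients, since real and complex diagonal matrices both occur.\<close>

definition diagonal :: "('n \<Rightarrow> 'a::zero) \<Rightarrow> 'a^'n^'n" where
  "diagonal d = (\<chi> i j. if i = j then d i else 0)"

lemma diagonal_nth: "diagonal d $ i $ j = (if i = j then d i else 0)"
  by (simp add: diagonal_def)

lemma diagonal_mult_nth: "(diagonal d ** X) $ i $ j = d i * X $ i $ j"
  for X :: "'a::semiring_1^'m^'n::finite"
  by (simp add: diagonal_def matrix_matrix_mult_def if_distrib[of "\<lambda>x. x * _"] cong: if_cong)

lemma mult_diagonal_nth: "(X ** diagonal d) $ i $ j = X $ i $ j * d j"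
  for X :: "'a::semiring_1^'n::finite^'m"
  by (simp add: diagonal_def matrix_matrix_mult_def if_distrib[of "\<lambda>x. _ * x"] cong: if_cong)

lemma sym_mat_nth: "sym_mat A \<Longrightarrow> A $ i $ j = A $ j $ i"
  unfolding sym_mat_def transpose_def by (metis vec_lambda_beta)

lemma norm_matrix_squared: "(norm X)\<^sup>2 = (\<Sum>i\<in>UNIV. \<Sum>j\<in>UNIV. (X $ i $ j)\<^sup>2)"
  for X :: "real^'n::finite^'m::finite"
  by (simp add: power2_norm_eq_inner inner_vec_def flip: power2_eq_square)

lemma GrD:
  assumes "P \<in> Gr m"
  shows "sym_mat P" "P ** P = P" "trace P = real m"
  using assms by (auto simp: Gr_def)

text \<open>Diagonal entries of P = P P^T. This is what converts sums of squared entries into traces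
  below.\<close>

lemma Gr_diagonal_entry:
  assumes "P \<in> Gr m"
  shows "(\<Sum>j\<in>UNIV. (P $ i $ j)\<^sup>2) = P $ i $ i"
proof -
  have "P $ i $ i = (P ** P) $ i $ i"
    using GrD[OF assms] by simp
  also have "\<dots> = (\<Sum>j\<in>UNIV. (P $ i $ j)\<^sup>2)"
    using sym_mat_nth[OF GrD(1)[OF assms]]
    by (simp add: matrix_matrix_mult_def power2_eq_square)
  finally show ?thesis by simp
qed

lemma Gr_diagonal_bounds:
  assumes "P \<in> Gr m"
  shows "0 \<le> P $ i $ i" "P $ i $ i \<le> 1"
proof -
  show 0: "0 \<le> P $ i $ i"
    by (metis Gr_diagonal_entry[OF assms] sum_nonneg zero_le_power2)
  have "(P $ i $ i)\<^sup>2 \<le> (\<Sum>j\<in>UNIV. (P $ i $ j)\<^sup>2)"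
    by (rule member_le_sum) auto
  then have "P $ i $ i * P $ i $ i \<le> 1 * P $ i $ i"
    using Gr_diagonal_entry[OF assms] by (simp add: power2_eq_square)
  then show "P $ i $ i \<le> 1"
    using 0 mult_right_le_imp_le[of "P $ i $ i" "P $ i $ i" 1] by (cases "P $ i $ i = 0") auto
qed

lemma Gr_norm:
  assumes "P \<in> Gr m"
  shows "(norm P)\<^sup>2 = real m"
  using Gr_diagonal_entry[OF assms] GrD(3)[OF assms] by (simp add: norm_matrix_squared trace_def)

lemma continuous_on_transpose [continuous_intros]:
  "continuous_on S f \<Longrightarrow> continuous_on S (\<lambda>x. transpose (f x :: 'a::topological_space^'n^'m))"
  unfolding transpose_def by (intro continuous_intros)

lemma continuous_on_trace [continuous_intros]:
  "continuous_on S f \<Longrightarrow> continuous_on S (\<lambda>x. trace (f x :: real^'n^'n))"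
  unfolding trace_def by (intro continuous_intros)

lemma compact_Gr: "compact (Gr m :: (real^'n::finite^'n) set)"
  unfolding compact_eq_bounded_closed
proof
  show "bounded (Gr m :: (real^'n^'n) set)"
    unfolding bounded_iff by (metis Gr_norm norm_ge_zero real_sqrt_unique order_refl)
  have "Gr m = {P :: real^'n^'n. transpose P = P} \<inter> {P. P ** P = P} \<inter> {P. trace P = real m}"
    by (auto simp: Gr_def sym_mat_def)
  also have "closed \<dots>"
    by (intro closed_Int closed_Collect_eq continuous_intros)
  finally show "closed (Gr m :: (real^'n^'n) set)" .
qed

lemma diagonal_indicator_in_Gr: "diagonal (\<lambda>i. if i \<in> S then 1 else 0) \<in> Gr (card S)"
  by (auto simp: Gr_def sym_mat_def vec_eq_iff diagonal_mult_nth diagonal_nth transpose_def trace_def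
      sum.If_cases)

text \<open>Since \<open>P\<^sup>2 = P\<close>, writing \<open>a\<^sub>i a\<^sub>j\<close> as \<open>(a\<^sub>i\<^sup>2 + a\<^sub>j\<^sup>2 - (a\<^sub>i - a\<^sub>j)\<^sup>2) / 2\<close> turns the quadratic
  part of \<open>J\<close> into a linear one up to a nonnegative remainder.\<close>
lemma J_diagonal:
  assumes "P \<in> Gr m"
  shows "J (diagonal a) (diagonal b) P =
    (\<Sum>i\<in>UNIV. (b i - 1/2 * (a i)\<^sup>2) * P $ i $ i) + 1/4 * (\<Sum>i\<in>UNIV. \<Sum>j\<in>UNIV. (a i - a j)\<^sup>2 * (P $ i $ j)\<^sup>2)"
proof -
  note s = sym_mat_nth[OF GrD(1)[OF assms]] and e = Gr_diagonal_entry[OF assms]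
  have 1: "(\<Sum>i\<in>UNIV. \<Sum>j\<in>UNIV. (a i)\<^sup>2 * (P $ i $ j)\<^sup>2) = (\<Sum>i\<in>UNIV. (a i)\<^sup>2 * P $ i $ i)"
    by (simp add: e flip: sum_distrib_left)
  have 2: "(\<Sum>i\<in>UNIV. \<Sum>j\<in>UNIV. (a j)\<^sup>2 * (P $ i $ j)\<^sup>2) = (\<Sum>i\<in>UNIV. (a i)\<^sup>2 * P $ i $ i)"
    unfolding 1[symmetric] by (subst sum.swap, intro sum.cong refl) (metis s)
  have "trace (diagonal a ** P ** diagonal a ** P) = (\<Sum>i\<in>UNIV. \<Sum>j\<in>UNIV. a i * a j * (P $ i $ j)\<^sup>2)"
    unfolding trace_def matrix_matrix_mult_def[of "_ ** diagonal a"]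
    using s by (simp add: mult_diagonal_nth diagonal_mult_nth power2_eq_square mult_ac)
  moreover have "(\<Sum>i\<in>UNIV. \<Sum>j\<in>UNIV. (a i - a j)\<^sup>2 * (P $ i $ j)\<^sup>2) =
      2 * (\<Sum>i\<in>UNIV. (a i)\<^sup>2 * P $ i $ i) - 2 * (\<Sum>i\<in>UNIV. \<Sum>j\<in>UNIV. a i * a j * (P $ i $ j)\<^sup>2)"
  proof -
    have "(\<Sum>i\<in>UNIV. \<Sum>j\<in>UNIV. (a i - a j)\<^sup>2 * (P $ i $ j)\<^sup>2) =
      (\<Sum>i\<in>UNIV. \<Sum>j\<in>UNIV. (a i)\<^sup>2 * (P $ i $ j)\<^sup>2) + (\<Sum>i\<in>UNIV. \<Sum>j\<in>UNIV. (a j)\<^sup>2 * (P $ i $ j)\<^sup>2)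
      - 2 * (\<Sum>i\<in>UNIV. \<Sum>j\<in>UNIV. a i * a j * (P $ i $ j)\<^sup>2)"
      unfolding sum_distrib_left sum.distrib[symmetric] sum_subtractf[symmetric]
      by (simp add: power2_diff algebra_simps)
    then show ?thesis by (simp only: 1 2)
  qed
  moreover have "trace (diagonal b ** P) = (\<Sum>i\<in>UNIV. b i * P $ i $ i)"
    by (simp add: trace_def diagonal_mult_nth)
  moreover have "(\<Sum>i\<in>UNIV. (b i - 1/2 * (a i)\<^sup>2) * P $ i $ i) =
      (\<Sum>i\<in>UNIV. b i * P $ i $ i) - 1/2 * (\<Sum>i\<in>UNIV. (a i)\<^sup>2 * P $ i $ i)"
    by (simp add: left_diff_distrib sum_subtractf sum_distrib_left mult.assoc)
  ultimately show ?thesis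
    unfolding J_def by linarith
qed

text \<open>The commutator remainder in \<open>J_diagonal\<close> is nonnegative and vanishes at
  \<open>P0\<close>, so only the linear part with coefficients \<open>c\<close> has to be compared.
  Moving diagonal mass \<open>t\<close> from \<open>S\<close> to its complement costs at least
  \<open>(\<nu> - \<mu>) * t\<close>, and the squared distance to \<open>P0\<close> is exactly
  \<open>2 * t\<close>.\<close>

lemma J_diagonal_quadratic_growth:
  fixes a b :: "'n::finite \<Rightarrow> real" and S :: "'n set"
  defines "c \<equiv> \<lambda>i. b i - 1/2 * (a i)\<^sup>2"
    and "P0 \<equiv> diagonal (\<lambda>i. if i \<in> S then 1 else 0)"
  assumes P: "P \<in> Gr (card S)"
    and occ: "\<And>i. i \<in> S \<Longrightarrow> c i \<le> \<mu>" and virt: "\<And>i. i \<notin> S \<Longrightarrow> \<nu> \<le> c i"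
  shows "(\<nu> - \<mu>) / 2 * (norm (P - P0))\<^sup>2 \<le> J (diagonal a) (diagonal b) P - J (diagonal a) (diagonal b) P0"
proof -
  have split: "sum f UNIV = sum f S + sum f (- S)" for f :: "'n \<Rightarrow> real"
    using sum.union_disjoint[of S "- S" f] by simp
  \<comment> \<open>The diagonal mass of \<open>P\<close> outside \<open>S\<close>; since the trace
    is \<open>card S\<close>, the same amount is missing on \<open>S\<close>.\<close>
  define t where "t = (\<Sum>i\<in>- S. P $ i $ i)"
  have tS: "(\<Sum>i\<in>S. P $ i $ i) = real (card S) - t"
    using GrD(3)[OF P] split[of "\<lambda>i. P $ i $ i"] by (simp add: trace_def t_def)
  have "(P0 $ i $ j)\<^sup>2 = P0 $ i $ j" for i j
    by (simp add: P0_def diagonal_nth)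
  then have "(norm (P - P0))\<^sup>2 = (\<Sum>i\<in>UNIV. \<Sum>j\<in>UNIV. (P $ i $ j)\<^sup>2 - 2 * (P $ i $ j * P0 $ i $ j) + P0 $ i $ j)"
    by (simp add: norm_matrix_squared power2_diff algebra_simps)
  also have "\<dots> = real (card S) - 2 * (\<Sum>i\<in>UNIV. if i \<in> S then P $ i $ i else 0) + (\<Sum>i\<in>UNIV. if i \<in> S then 1 else 0)"
    using GrD(3)[OF P]
    by (simp add: sum.distrib sum_subtractf Gr_diagonal_entry[OF P] trace_def P0_def diagonal_nth
        if_distrib[of "\<lambda>x. _ * x"] sum.If_cases flip: sum_distrib_left cong: if_cong)
  also have "\<dots> = 2 * t"
    by (simp add: sum.If_cases tS)
  finally have n: "(norm (P - P0))\<^sup>2 = 2 * t" .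
  have J0: "J (diagonal a) (diagonal b) P0 = (\<Sum>i\<in>S. c i)"
  proof -
    have "(\<Sum>i\<in>UNIV. \<Sum>j\<in>UNIV. (a i - a j)\<^sup>2 * (P0 $ i $ j)\<^sup>2) = 0"
      by (intro sum.neutral ballI) (simp add: P0_def diagonal_nth)
    moreover have "P0 \<in> Gr (card S)"
      unfolding P0_def by (rule diagonal_indicator_in_Gr)
    ultimately show ?thesis
      unfolding J_diagonal[OF \<open>P0 \<in> _\<close>]
      by (simp only:) (simp add: P0_def diagonal_nth if_distrib[of "\<lambda>x. _ * x"] sum.If_cases c_def cong: if_cong)
  qed
  have "(\<nu> - \<mu>) * t = \<mu> * (\<Sum>i\<in>S. P $ i $ i - 1) + \<nu> * t"
    by (simp add: sum_subtractf tS algebra_simps)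
  \<comment> \<open>On \<open>S\<close> the factors \<open>P $ i $ i - 1\<close> are nonpositive, so
    the upper bound \<open>c i \<le> \<mu>\<close> yields a lower bound.\<close>
  also have "\<dots> \<le> (\<Sum>i\<in>S. c i * (P $ i $ i - 1)) + (\<Sum>i\<in>-S. c i * P $ i $ i)"
    unfolding t_def sum_distrib_left using occ virt Gr_diagonal_bounds[OF P]
    by (intro add_mono sum_mono mult_right_mono mult_right_mono_neg) auto
  also have "\<dots> = (\<Sum>i\<in>UNIV. c i * P $ i $ i) - (\<Sum>i\<in>S. c i)"
    by (simp add: split right_diff_distrib sum_subtractf)
  also have "\<dots> \<le> J (diagonal a) (diagonal b) P - J (diagonal a) (diagonal b) P0"
    unfolding J0 J_diagonal[OF P] c_def by (simp add: sum_nonneg)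
  finally show ?thesis using n by simp
qed

section \<open>First-order condition along rotations of the range\<close>

lemma has_vector_derivative_matrix_mult [derivative_intros]:
  fixes f g :: "real \<Rightarrow> ('a::{real_normed_algebra_1,euclidean_space})^'n^'n"
  assumes "(f has_vector_derivative f') (at x)" "(g has_vector_derivative g') (at x)"
  shows "((\<lambda>t. f t ** g t) has_vector_derivative f x ** g' + f' ** g x) (at x)"
  by (rule bounded_bilinear.has_vector_derivative[OF bounded_bilinear_matrix_mult assms])

lemma has_real_derivative_trace:
  fixes f :: "real \<Rightarrow> real^'n^'n"
  assumes "(f has_vector_derivative f') (at x)"
  shows "((\<lambda>t. trace (f t)) has_real_derivative trace f') (at x)"
proof -
  have "bounded_linear (trace :: real^'n^'n \<Rightarrow> real)"
    unfolding trace_def by (intro bounded_linear_sum bounded_linear_intros bounded_linear_vec_nth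
        bounded_linear_compose[OF bounded_linear_vec_nth])
  from bounded_linear.has_vector_derivative[OF this assms] show ?thesis
    by (simp add: has_real_derivative_iff_has_vector_derivative)
qed

definition outer :: "real^'n \<Rightarrow> real^'n \<Rightarrow> real^'n^'n" where
  "outer u v = (\<chi> i j. u $ i * v $ j)"

lemma matrix_mult_outer: "A ** outer u v = outer (A *v u) v"
  by (simp add: outer_def matrix_matrix_mult_def matrix_vector_mult_def vec_eq_iff sum_distrib_left mult_ac)

lemma transpose_outer: "transpose (outer u v) = outer v u"
  by (simp add: outer_def transpose_def vec_eq_iff mult_ac)

lemma outer_matrix_mult: "outer u v ** A = outer u (transpose A *v v)"
  by (metis matrix_mult_outer matrix_transpose_mul transpose_outer transpose_transpose)

lemma outer_mult_vec: "outer u v *v x = (v \<bullet> x) *\<^sub>R u"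
  by (simp add: outer_def matrix_vector_mult_def vec_eq_iff inner_vec_def sum_distrib_left sum_distrib_right mult_ac)

lemma trace_outer: "trace (outer u v) = u \<bullet> v"
  by (simp add: outer_def trace_def inner_vec_def)

lemma outer_0: "outer 0 v = 0" "outer u 0 = 0"
  by (simp_all add: outer_def vec_eq_iff)

lemma transpose_diff: "transpose (A - B) = transpose A - transpose B"
  for A B :: "'a::ab_group_add^'n^'m"
  by (simp add: transpose_def vec_eq_iff)

lemma transpose_add: "transpose (A + B) = transpose A + transpose B"
  for A B :: "'a::plus^'n^'m"
  by (simp add: transpose_def vec_eq_iff)

lemma inner_sym_mat: "sym_mat A \<Longrightarrow> (A *v x) \<bullet> y = x \<bullet> (A *v y)"
  unfolding sym_mat_def by (metis dot_lmul_matrix transpose_matrix_vector)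

text \<open>Turning the direction \<open>u\<close> of the range into w = cos t u + sin t v replaces
  P by P - u u^T + w w^T, a sum of two orthogonal projectors with orthogonal ranges. The expanded
  form makes the tangent u v^T + v u^T at t = 0 visible.\<close>

lemma Gr_rotate:
  assumes P: "P \<in> Gr m" and u: "norm u = 1" "P *v u = u" and v: "norm v = 1" "P *v v = 0"
  shows "P + (cos t * sin t) *\<^sub>R (outer u v + outer v u) + (sin t)\<^sup>2 *\<^sub>R (outer v v - outer u u) \<in> Gr m"
    (is "?R \<in> _")
proof -
  have sP: "transpose P = P" and PP: "P ** P = P" and tP: "trace P = real m"
    using GrD[OF P] by (auto simp: sym_mat_def)
  have uu: "u \<bullet> u = 1" and vv: "v \<bullet> v = 1"
    using u v by (simp_all add: norm_eq_1)
  have uv: "u \<bullet> v = 0"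
    using inner_sym_mat[OF GrD(1)[OF P], of u v] u v by simp
  define w where "w = cos t *\<^sub>R u + sin t *\<^sub>R v"
  define Q where "Q = P - outer u u"
  have "w \<bullet> w = (cos t)\<^sup>2 + (sin t)\<^sup>2"
    using uu vv uv by (simp add: w_def inner_add_left inner_add_right inner_commute power2_eq_square)
  then have ww: "w \<bullet> w = 1" by simp
  have Pw: "P *v w = cos t *\<^sub>R u"
    using u v by (simp add: w_def matrix_vector_right_distrib matrix_vector_mult_scaleR)
  have Qw: "Q *v w = 0"
    using Pw uu uv by (simp add: Q_def matrix_vector_mult_diff_rdistrib outer_mult_vec w_def inner_add_right)
  have R: "?R = Q + outer w w"
  proof -
    have c: "(cos t)\<^sup>2 = 1 - (sin t)\<^sup>2" by (simp add: cos_squared_eq)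
    have "outer w w = (cos t)\<^sup>2 *\<^sub>R outer u u + (cos t * sin t) *\<^sub>R (outer u v + outer v u) + (sin t)\<^sup>2 *\<^sub>R outer v v"
      by (simp add: w_def outer_def vec_eq_iff power2_eq_square algebra_simps)
    then show ?thesis unfolding c Q_def by (simp add: algebra_simps)
  qed
  have tQ: "transpose Q = Q"
    using sP by (simp add: Q_def transpose_diff transpose_outer)
  have QQ: "Q ** Q = Q"
    using PP u uu by (simp add: Q_def matrix_diff_ldistrib matrix_diff_rdistrib matrix_mult_outer outer_matrix_mult
        sP transpose_outer outer_mult_vec matrix_vector_mult_diff_rdistrib outer_0)
  have "transpose (Q + outer w w) = Q + outer w w"
    using tQ by (simp add: transpose_add transpose_outer)
  moreover have "(Q + outer w w) ** (Q + outer w w) = Q + outer w w"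
    using QQ Qw ww by (simp add: matrix_add_ldistrib matrix_add_rdistrib matrix_mult_outer outer_matrix_mult tQ
        outer_mult_vec matrix_vector_mult_add_rdistrib outer_0)
  moreover have "trace (Q + outer w w) = real m"
    using ww uu tP by (simp add: Q_def trace_add trace_sub trace_outer)
  ultimately show ?thesis
    unfolding R by (simp add: Gr_def sym_mat_def)
qed

text \<open>\<open>B - A ** P ** A\<close> is the gradient of \<open>J A B\<close> at
  \<open>P\<close>. Stationarity along all rotations makes it map the range of \<open>P\<close> into
  itself; being symmetric, it then commutes with \<open>P\<close>.\<close>

lemma J_minimizer_stationary:
  fixes A B P :: "real^'n::finite^'n"
  assumes min: "is_arg_min (J A B) (\<lambda>Q. Q \<in> Gr m) P" and A: "sym_mat A" and B: "sym_mat B"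
  shows "(B - A ** P ** A) ** P = P ** (B - A ** P ** A)"
proof -
  have P: "P \<in> Gr m" and le: "\<And>Q. Q \<in> Gr m \<Longrightarrow> J A B P \<le> J A B Q"
    using min by (auto simp: is_arg_min_def not_less)
  define H where "H = B - A ** P ** A"
  have sP: "transpose P = P" and PP: "P ** P = P"
    using GrD[OF P] by (auto simp: sym_mat_def)
  have sH: "transpose H = H"
    using A B sP by (simp add: H_def sym_mat_def transpose_diff matrix_transpose_mul matrix_mul_assoc)
  have unit: "v \<bullet> (H *v u) = 0" if uv: "norm u = 1" "P *v u = u" "norm v = 1" "P *v v = 0" for u v
  proof -
    define E where "E = outer u v + outer v u"
    define R where "R t = P + (cos t * sin t) *\<^sub>R E + (sin t)\<^sup>2 *\<^sub>R (outer v v - outer u u)" for t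
    have R0: "R 0 = P" by (simp add: R_def)
    have dR: "(R has_vector_derivative E) (at 0)"
      unfolding R_def by (auto intro!: derivative_eq_intros)
    have "((\<lambda>t. J A B (R t)) has_real_derivative
        trace (B ** E) - 1/2 * trace (A ** P ** A ** E + A ** E ** A ** P)) (at 0)"
      unfolding J_def
      by (rule derivative_eq_intros has_real_derivative_trace dR refl | simp add: R0)+
    \<comment> \<open>By cyclicity both halves of the derivative of the quadratic term agree, which
      absorbs the factor 1/2.\<close>
    moreover have "trace (A ** E ** A ** P) = trace (A ** P ** A ** E)"
      using trace_mul_sym[of "A ** E" "A ** P"] by (simp add: matrix_mul_assoc)
    ultimately have "((\<lambda>t. J A B (R t)) has_real_derivative trace (H ** E)) (at 0)"
      by (simp add: trace_add trace_sub H_def matrix_diff_rdistrib)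
    moreover have "J A B (R 0) \<le> J A B (R t)" for t
      unfolding R0 using Gr_rotate[OF P uv, of t] by (intro le) (simp add: R_def E_def)
    ultimately have "trace (H ** E) = 0"
      by (intro DERIV_local_min[of _ _ 0 1]) auto
    moreover have "(H *v v) \<bullet> u = v \<bullet> (H *v u)" using sH by (simp add: inner_sym_mat sym_mat_def)
    ultimately show ?thesis
      by (simp add: E_def matrix_add_ldistrib matrix_mult_outer trace_add trace_outer inner_commute)
  qed
  \<comment> \<open>Any vector of the range has the form \<open>P *v x\<close> and any vector of the
    kernel the form \<open>y - P *v y\<close>; normalizing reduces to \<open>unit\<close>, and zero
    vectors are trivial.\<close>
  have orth: "(y - P *v y) \<bullet> (H *v (P *v x)) = 0" for x y
  proof (cases "P *v x = 0 \<or> y - P *v y = 0")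
    case False
    let ?u = "P *v x" and ?v = "y - P *v y"
    have "P *v ?u = ?u" "P *v ?v = 0"
      by (simp_all add: matrix_vector_mul_assoc PP matrix_vector_mult_diff_distrib)
    then have "(?v /\<^sub>R norm ?v) \<bullet> (H *v (?u /\<^sub>R norm ?u)) = 0"
      using False by (intro unit) (simp_all add: matrix_vector_mult_scaleR)
    then show ?thesis
      using False by (simp add: matrix_vector_mult_scaleR)
  qed (metis inner_zero_left inner_zero_right matrix_vector_mult_0_right)
  have "y \<bullet> ((H ** P - P ** H ** P) *v x) = 0" for x y
    using orth[of y x] inner_sym_mat[OF GrD(1)[OF P], of y]
    by (simp add: inner_diff_left inner_diff_right matrix_vector_mult_diff_rdistrib flip: matrix_vector_mul_assoc)
  then have "(H ** P - P ** H ** P) *v x = 0" for x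
    by (metis inner_eq_zero_iff)
  then have HP: "H ** P = P ** H ** P"
    by (simp add: matrix_eq matrix_vector_mult_diff_rdistrib)
  also have "\<dots> = transpose (P ** H ** P)"
    by (simp add: matrix_transpose_mul sP sH matrix_mul_assoc)
  also have "\<dots> = transpose (H ** P)"
    unfolding HP ..
  finally show ?thesis
    by (simp add: H_def[symmetric] matrix_transpose_mul sP sH)
qed

section \<open>The fixed-point map\<close>

text \<open>Entrywise weights select blocks and divide by entry-dependent denominators while staying
  linear in the matrix.\<close>

definition hadamard :: "('n \<Rightarrow> 'n \<Rightarrow> 'a::times) \<Rightarrow> 'a^'n^'n \<Rightarrow> 'a^'n^'n" where
  "hadamard W X = (\<chi> i j. W i j * X $ i $ j)"

lemma hadamard_nth [simp]: "hadamard W X $ i $ j = W i j * X $ i $ j"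
  by (simp add: hadamard_def)

lemma bounded_linear_hadamard: "bounded_linear (hadamard W :: ('a::{real_algebra,euclidean_space})^'n^'n \<Rightarrow> _)"
  unfolding linear_conv_bounded_linear[symmetric]
  by (intro linearI) (simp_all add: vec_eq_iff distrib_left)

lemmas has_derivative_hadamard [derivative_intros] =
  bounded_linear.has_derivative[OF bounded_linear_hadamard]

lemmas continuous_on_hadamard [continuous_intros] =
  bounded_linear.continuous_on[OF bounded_linear_hadamard]

text \<open>Built from ring operations alone, so the same expression serves real matrices and their
  complex extension.\<close>

definition commutator_eq :: "'a::comm_ring_1^'n^'n \<Rightarrow> 'a^'n^'n \<Rightarrow> 'a^'n^'n \<Rightarrow> 'a^'n^'n" where
  "commutator_eq A B P = (B - A ** P ** A) ** P - P ** (B - A ** P ** A)"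

definition proj :: "'n set \<Rightarrow> 'a::zero_neq_one^'n^'n" where
  "proj S = diagonal (\<lambda>i. if i \<in> S then 1 else 0)"

lemma proj_nth:
  "proj S $ i $ j = (if i = j \<and> i \<in> S then 1 else 0)"
  by (simp add: proj_def diagonal_nth)

lemma proj_mult_nth: "(proj S ** X) $ i $ j = (if i \<in> S then X $ i $ j else 0)"
  for X :: "'a::{semiring_1,zero_neq_one}^'m^'n::finite"
  by (simp add: proj_def diagonal_mult_nth)

lemma mult_proj_nth: "(X ** proj S) $ i $ j = (if j \<in> S then X $ i $ j else 0)"
  for X :: "'a::{semiring_1,zero_neq_one}^'n::finite^'m"
  by (simp add: proj_def mult_diagonal_nth)

text \<open>At \<open>proj S\<close> and diagonal data, the linearized commutator multiplies the
  entry \<open>(i, j)\<close> with \<open>i \<in> S\<close>, \<open>j \<notin> S\<close> by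
  \<open>-(b j - b i + a i * (a i - a j))\<close>, and the transposed entry by the opposite number.
  The weight is minus the inverse of that factor.\<close>

definition update_weight :: "'n set \<Rightarrow> ('n \<Rightarrow> 'a::field) \<Rightarrow> ('n \<Rightarrow> 'a) \<Rightarrow> 'n \<Rightarrow> 'n \<Rightarrow> 'a" where
  "update_weight S a b i j =
    (if i \<in> S \<and> j \<notin> S then 1 / (b j - b i + a i * (a i - a j))
     else if i \<notin> S \<and> j \<in> S then - 1 / (b i - b j + a j * (a j - a i)) else 0)"

text \<open>With \<open>P = P\<^sub>0 + Q\<close>, the diagonal blocks of \<open>P\<^sup>2 = P\<close> read \<open>Q = \<mp> Q\<^sup>2\<close>; the off-diagonal blocks of
  the stationarity equation are divided by the corresponding entries of its linearization
  at \<open>P\<^sub>0\<close>. The first-order part of the map in \<open>Q\<close> then vanishes at the unperturbed solution.\<close>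
definition update :: "'n set \<Rightarrow> ('n \<Rightarrow> 'a::field) \<Rightarrow> ('n \<Rightarrow> 'a) \<Rightarrow> 'a^'n^'n \<Rightarrow> 'a^'n^'n \<Rightarrow> 'a^'n^'n \<Rightarrow> 'a^'n^'n" where
  "update S a b A B Q =
    hadamard (\<lambda>i j. if i \<in> S \<and> j \<in> S then - 1 else if i \<notin> S \<and> j \<notin> S then 1 else 0) (Q ** Q)
    + hadamard (\<lambda>i j. if i \<in> S \<longleftrightarrow> j \<in> S then 0 else 1) Q
    + hadamard (update_weight S a b) (commutator_eq A B (proj S + Q))"

definition update_deriv :: "'n set \<Rightarrow> ('n \<Rightarrow> 'a::field) \<Rightarrow> ('n \<Rightarrow> 'a) \<Rightarrow> 'a^'n^'n \<Rightarrow> 'a^'n^'n \<Rightarrow> 'a^'n^'n \<Rightarrow> 'a^'n^'n \<Rightarrow> 'a^'n^'n" where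
  "update_deriv S a b A B Q X =
    hadamard (\<lambda>i j. if i \<in> S \<and> j \<in> S then - 1 else if i \<notin> S \<and> j \<notin> S then 1 else 0) (Q ** X + X ** Q)
    + hadamard (\<lambda>i j. if i \<in> S \<longleftrightarrow> j \<in> S then 0 else 1) X
    + hadamard (update_weight S a b)
      ((B - A ** (proj S + Q) ** A) ** X + (- (A ** X ** A)) ** (proj S + Q)
       - ((proj S + Q) ** (- (A ** X ** A)) + X ** (B - A ** (proj S + Q) ** A)))"

lemma has_derivative_update:
  fixes A B Q :: "('a::{real_normed_field,euclidean_space})^'n::finite^'n"
  shows "(update S a b A B has_derivative update_deriv S a b A B Q) (at Q)"
  unfolding update_def[abs_def] update_deriv_def[abs_def] commutator_eq_def
  by (rule derivative_eq_intros has_derivative_matrix_mult refl | simp)+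

lemma continuous_on_update_deriv:
  fixes X :: "('a::{real_normed_field,euclidean_space})^'n::finite^'n"
  shows "continuous_on T (\<lambda>(p, Q). update_deriv S a b (fst p) (snd p) Q X)"
  unfolding update_deriv_def case_prod_beta by (intro continuous_intros)

lemma continuous_on_update:
  fixes Q :: "('a::{real_normed_field,euclidean_space})^'n::finite^'n"
  shows "continuous_on T (\<lambda>p. update S a b (fst p) (snd p) Q)"
  unfolding update_def commutator_eq_def by (intro continuous_intros)

lemma uminus_matrix_mult_nth: "(- X ** Y) $ i $ j = - (X ** Y) $ i $ j" "(X ** - Y) $ i $ j = - (X ** Y) $ i $ j"
  for X :: "'a::ring_1^'n^'m"
  by (simp_all add: matrix_matrix_mult_def sum_negf)

text \<open>At \<open>Q = 0\<close> the derivative of the quadratic term vanishes; off the diagonal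
  blocks the weighted commutator contributes \<open>- X\<close>, which cancels the identity
  term.\<close>

lemma update_deriv_diagonal:
  fixes X :: "'a::field^'n::finite^'n"
  assumes "\<And>i j. i \<in> S \<Longrightarrow> j \<notin> S \<Longrightarrow> b j - b i + a i * (a i - a j) \<noteq> 0"
  shows "update_deriv S a b (diagonal a) (diagonal b) 0 X = 0"
proof -
  have 0: "X ** 0 = 0" "0 ** X = 0" by (simp_all add: vec_eq_iff matrix_matrix_mult_def)
  have H: "diagonal b - diagonal a ** proj S ** diagonal a = diagonal (\<lambda>i. b i - (if i \<in> S then (a i)\<^sup>2 else 0))"
    by (simp add: vec_eq_iff diagonal_mult_nth mult_diagonal_nth diagonal_nth mult_proj_nth proj_nth power2_eq_square)
  show ?thesis
    using assms
    by (auto simp: update_deriv_def vec_eq_iff 0 H diagonal_mult_nth mult_diagonal_nth uminus_matrix_mult_nth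
        proj_mult_nth mult_proj_nth update_weight_def power2_eq_square divide_simps)
      (simp_all add: algebra_simps)
qed

lemma update_diagonal:
  "update S a b (diagonal a) (diagonal b) (0 :: 'a::field^'n::finite^'n) = 0"
  by (simp add: vec_eq_iff update_def commutator_eq_def diagonal_mult_nth mult_diagonal_nth proj_mult_nth mult_proj_nth diagonal_nth)

text \<open>The commutator term vanishes whatever the weights are, and the diagonal blocks come from
  expanding \<open>(P - proj S) ** (P - proj S)\<close>.\<close>

lemma update_fixpoint:
  fixes P :: "'a::{field,real_algebra_1,euclidean_space}^'n::finite^'n"
  assumes "P ** P = P" "commutator_eq A B P = 0"
  shows "update S a b A B (P - proj S) = P - proj S"
proof -
  have "proj S ** proj S = (proj S :: 'a^'n^'n)"
    by (simp add: vec_eq_iff proj_mult_nth proj_nth)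
  then have "(P - proj S) ** (P - proj S) = P - proj S ** P - P ** proj S + proj S"
    using assms(1) by (simp add: matrix_diff_ldistrib matrix_diff_rdistrib)
  then show ?thesis
    using assms(2) by (auto simp: update_def vec_eq_iff proj_mult_nth mult_proj_nth proj_nth)
qed

section \<open>Holomorphic matrix functions and complexification of real matrices\<close>

definition matrix_holomorphic_on :: "complex set \<Rightarrow> (complex \<Rightarrow> complex^'n^'m) \<Rightarrow> bool" where
  "matrix_holomorphic_on S X \<longleftrightarrow> (\<forall>i j. (\<lambda>z. X z $ i $ j) holomorphic_on S)"

lemma matrix_holomorphic_intros:
  fixes X Y :: "complex \<Rightarrow> complex^'n^'n"
  shows "matrix_holomorphic_on S (\<lambda>z. C)"
    "\<lbrakk>matrix_holomorphic_on S X; matrix_holomorphic_on S Y\<rbrakk> \<Longrightarrow> matrix_holomorphic_on S (\<lambda>z. X z + Y z)"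
    "\<lbrakk>matrix_holomorphic_on S X; matrix_holomorphic_on S Y\<rbrakk> \<Longrightarrow> matrix_holomorphic_on S (\<lambda>z. X z - Y z)"
    "\<lbrakk>matrix_holomorphic_on S X; matrix_holomorphic_on S Y\<rbrakk> \<Longrightarrow> matrix_holomorphic_on S (\<lambda>z. X z ** Y z)"
    "matrix_holomorphic_on S X \<Longrightarrow> matrix_holomorphic_on S (\<lambda>z. hadamard W (X z))"
  unfolding matrix_holomorphic_on_def matrix_matrix_mult_def
  by (simp_all add: hadamard_def) (auto intro!: holomorphic_intros)

lemma matrix_holomorphic_on_update:
  assumes "matrix_holomorphic_on T A" "matrix_holomorphic_on T B" "matrix_holomorphic_on T Q"
  shows "matrix_holomorphic_on T (\<lambda>z. update S a b (A z) (B z) (Q z))"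
  unfolding update_def commutator_eq_def by (intro matrix_holomorphic_intros assms)

definition cmat :: "real^'n^'m \<Rightarrow> complex^'n^'m" where
  "cmat X = (\<chi> i j. complex_of_real (X $ i $ j))"

lemma cmat_nth [simp]: "cmat X $ i $ j = complex_of_real (X $ i $ j)"
  by (simp add: cmat_def)

lemma cmat_hom: "cmat (X + Y) = cmat X + cmat Y" "cmat (X - Y) = cmat X - cmat Y"
  by (simp_all add: vec_eq_iff)

lemma cmat_mult: "cmat (X ** Y) = cmat X ** cmat Y"
  by (simp add: vec_eq_iff matrix_matrix_mult_def)

lemma cmat_diagonal: "cmat (diagonal d) = diagonal (\<lambda>i. complex_of_real (d i))"
  by (simp add: vec_eq_iff diagonal_nth)

lemma cmat_proj: "cmat (proj S) = proj S"
  by (simp add: vec_eq_iff proj_nth)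

lemma norm_cmat [simp]: "norm (cmat X) = norm X"
  by (simp add: norm_vec_def L2_set_def)

section \<open>Analytic dependence\<close>

lemma sums_matrix_iff: "X sums Y \<longleftrightarrow> (\<forall>i j. (\<lambda>n. X n $ i $ j) sums (Y $ i $ j))"
  for Y :: "'a::real_normed_vector^'n^'m"
proof (intro iffI allI)
  show "(\<lambda>n. X n $ i $ j) sums (Y $ i $ j)" if "X sums Y" for i j
    using bounded_linear.sums[OF bounded_linear_vec_nth bounded_linear.sums[OF bounded_linear_vec_nth that]] .
  show "X sums Y" if *: "\<forall>i j. (\<lambda>n. X n $ i $ j) sums (Y $ i $ j)"
    unfolding sums_def
  proof (intro vec_tendstoI)
    show "(\<lambda>n. sum X {..<n} $ i $ j) \<longlonglongrightarrow> Y $ i $ j" for i j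
      using * by (simp add: sums_def sum_component)
  qed
qed

text \<open>The same real coefficients are used with a complex variable.\<close>

lemma matrix_power_series_extension:
  fixes X :: "real \<Rightarrow> real^'n^'m"
  assumes "\<forall>\<^sub>F \<epsilon> in nhds 0. (\<lambda>n. \<epsilon> ^ n *\<^sub>R Xn n) sums X \<epsilon>"
  obtains Y \<rho> where "\<rho> > 0" "matrix_holomorphic_on (ball 0 \<rho>) Y"
    "\<And>\<epsilon>. \<bar>\<epsilon>\<bar> < \<rho> \<Longrightarrow> Y (complex_of_real \<epsilon>) = cmat (X \<epsilon>)"
proof -
  obtain d where d: "d > 0" and X: "\<And>\<epsilon>. \<bar>\<epsilon>\<bar> < d \<Longrightarrow> (\<lambda>n. \<epsilon> ^ n *\<^sub>R Xn n) sums X \<epsilon>"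
    using assms unfolding eventually_nhds_metric by (auto simp: dist_norm)
  have *: "(\<lambda>n. Xn n $ i $ j * \<epsilon> ^ n) sums (X \<epsilon> $ i $ j)" if "\<bar>\<epsilon>\<bar> < d" for \<epsilon> i j
    using X[OF that, unfolded sums_matrix_iff, rule_format, of i j] by (simp add: mult.commute)
  define Y where "Y z = (\<chi> i j. \<Sum>n. complex_of_real (Xn n $ i $ j) * z ^ n)" for z
  \<comment> \<open>Convergence at the real point \<open>d/2\<close> gives convergence on the open
    complex disc of that radius; hence the halved radius.\<close>
  have Y: "(\<lambda>n. complex_of_real (Xn n $ i $ j) * z ^ n) sums (Y z $ i $ j)" if z: "norm z < d/2" for z i j
  proof -
    have "(\<lambda>n. complex_of_real (Xn n $ i $ j * (d/2) ^ n)) sums complex_of_real (X (d/2) $ i $ j)"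
      using d by (intro sums_of_real *) auto
    then have "summable (\<lambda>n. complex_of_real (Xn n $ i $ j) * complex_of_real (d/2) ^ n)"
      by (simp add: sums_iff)
    then have "summable (\<lambda>n. complex_of_real (Xn n $ i $ j) * z ^ n)"
      by (rule powser_inside) (use d z in auto)
    then show ?thesis by (simp add: Y_def summable_sums)
  qed
  show thesis
  proof
    show "d/2 > 0" using d by simp
    show "matrix_holomorphic_on (ball 0 (d/2)) Y"
      unfolding matrix_holomorphic_on_def
    proof (intro allI power_series_holomorphic)
      show "(\<lambda>n. complex_of_real (Xn n $ i $ j) * (w - 0) ^ n) sums (Y w $ i $ j)" if "w \<in> ball 0 (d/2)" for i j w
        using Y that by simp
    qed
    show "Y (complex_of_real \<epsilon>) = cmat (X \<epsilon>)" if "\<bar>\<epsilon>\<bar> < d/2" for \<epsilon>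
    proof -
      have "Y (complex_of_real \<epsilon>) $ i $ j = complex_of_real (X \<epsilon> $ i $ j)" for i j
      proof (rule sums_unique2)
        show "(\<lambda>n. complex_of_real (Xn n $ i $ j) * complex_of_real \<epsilon> ^ n) sums (Y (complex_of_real \<epsilon>) $ i $ j)"
          using that by (intro Y) simp
        show "(\<lambda>n. complex_of_real (Xn n $ i $ j) * complex_of_real \<epsilon> ^ n) sums complex_of_real (X \<epsilon> $ i $ j)"
          using sums_of_real[OF *[of \<epsilon> i j]] that d by simp
      qed
      then show ?thesis by (simp add: vec_eq_iff)
    qed
  qed
qed

text \<open>Taylor expansion at a real centre \<open>x\<close>, on the largest disc about
  \<open>x\<close> inside the ball. For real \<open>y\<close> the powers of \<open>y - x\<close> are
  real, so real parts may be taken coefficientwise.\<close>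

lemma real_analytic_on_Re:
  assumes "matrix_holomorphic_on (ball 0 \<rho>) f"
  shows "real_analytic_on {-\<rho><..<\<rho>} (\<lambda>\<epsilon>. \<chi> i j. Re (f (complex_of_real \<epsilon>) $ i $ j))"
  unfolding real_analytic_on_def
proof
  fix x assume x: "x \<in> {-\<rho><..<\<rho>}"
  define c where "c n i j = (deriv ^^ n) (\<lambda>z. f z $ i $ j) (complex_of_real x) / fact n" for n i j
  have sub: "ball (complex_of_real x) (\<rho> - \<bar>x\<bar>) \<subseteq> ball 0 \<rho>"
  proof
    fix w assume "w \<in> ball (complex_of_real x) (\<rho> - \<bar>x\<bar>)"
    then have "norm (w - complex_of_real x) < \<rho> - \<bar>x\<bar>" by (simp add: dist_norm norm_minus_commute)
    moreover have "norm w \<le> norm (w - complex_of_real x) + norm (complex_of_real x)"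
      by (metis diff_add_cancel norm_triangle_ineq)
    ultimately show "w \<in> ball 0 \<rho>" by simp
  qed
  have "(\<lambda>n. (y - x) ^ n *\<^sub>R (\<chi> i j. Re (c n i j))) sums (\<chi> i j. Re (f (complex_of_real y) $ i $ j))"
    if y: "\<bar>y - x\<bar> < \<rho> - \<bar>x\<bar>" for y
    unfolding sums_matrix_iff
  proof (intro allI)
    fix i j
    have "(\<lambda>n. c n i j * (complex_of_real y - complex_of_real x) ^ n) sums (f (complex_of_real y) $ i $ j)"
      unfolding c_def
    proof (rule holomorphic_power_series)
      show "(\<lambda>z. f z $ i $ j) holomorphic_on ball (complex_of_real x) (\<rho> - \<bar>x\<bar>)"
        using assms sub unfolding matrix_holomorphic_on_def by (meson holomorphic_on_subset)
      show "complex_of_real y \<in> ball (complex_of_real x) (\<rho> - \<bar>x\<bar>)"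
        using y by (simp add: dist_norm norm_minus_commute flip: of_real_diff)
    qed
    from sums_Re[OF this]
    have "(\<lambda>n. Re (c n i j) * (y - x) ^ n) sums Re (f (complex_of_real y) $ i $ j)"
      by (simp only: of_real_diff[symmetric] of_real_power[symmetric] Re_complex_of_real Im_complex_of_real
          times_complex.sel mult_zero_right diff_zero)
    then show "(\<lambda>n. ((y - x) ^ n *\<^sub>R (\<chi> i j. Re (c n i j))) $ i $ j)
        sums ((\<chi> i j. Re (f (complex_of_real y) $ i $ j)) $ i $ j)"
      by (simp add: mult.commute)
  qed
  moreover have "\<rho> - \<bar>x\<bar> > 0" using x by auto
  ultimately show "\<exists>a r. r > 0 \<and> (\<forall>y. \<bar>y - x\<bar> < r \<longrightarrow>
      (\<lambda>n. (y - x) ^ n *\<^sub>R a n) sums (\<chi> i j. Re (f (complex_of_real y) $ i $ j)))"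
    by (intro exI[of _ "\<lambda>n. \<chi> i j. Re (c n i j)"] exI[of _ "\<rho> - \<bar>x\<bar>"]) blast
qed

lemma power_series_derivative_0:
  fixes X :: "real \<Rightarrow> real^'n^'m"
  assumes "\<forall>\<^sub>F \<epsilon> in nhds 0. (\<lambda>n. \<epsilon> ^ n *\<^sub>R Xn n) sums X \<epsilon>"
  shows "X 0 = Xn 0" "(X has_vector_derivative Xn 1) (at 0)"
proof -
  obtain d where d: "d > 0" and X: "\<And>\<epsilon>. \<bar>\<epsilon>\<bar> < d \<Longrightarrow> (\<lambda>n. \<epsilon> ^ n *\<^sub>R Xn n) sums X \<epsilon>"
    using assms unfolding eventually_nhds_metric by (auto simp: dist_norm)
  have *: "(\<lambda>n. Xn n $ i $ j * \<epsilon> ^ n) sums (X \<epsilon> $ i $ j)" if "\<bar>\<epsilon>\<bar> < d" for \<epsilon> i j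
    using X[OF that, unfolded sums_matrix_iff, rule_format, of i j] by (simp add: mult.commute)
  show "X 0 = Xn 0"
    unfolding vec_eq_iff
    by (intro allI sums_unique2[OF * powser_sums_zero]) (use d in simp)
  have D: "((\<lambda>\<epsilon>. X \<epsilon> $ i $ j) has_real_derivative Xn 1 $ i $ j) (at 0)" for i j
  proof -
    have "summable (\<lambda>n. Xn n $ i $ j * (d/2) ^ n)"
      using *[of "d/2" i j] d by (simp add: sums_iff)
    then have "((\<lambda>\<epsilon>. \<Sum>n. Xn n $ i $ j * \<epsilon> ^ n) has_real_derivative (\<Sum>n. diffs (\<lambda>n. Xn n $ i $ j) n * 0 ^ n)) (at 0)"
      by (rule termdiffs_strong) (use d in auto)
    then have "((\<lambda>\<epsilon>. \<Sum>n. Xn n $ i $ j * \<epsilon> ^ n) has_real_derivative Xn 1 $ i $ j) (at 0)"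
      by (simp add: powser_zero diffs_def)
    then show ?thesis
    proof (rule has_field_derivative_transform_within)
      show "(\<Sum>n. Xn n $ i $ j * \<epsilon> ^ n) = X \<epsilon> $ i $ j" if "dist \<epsilon> 0 < d" for \<epsilon>
        using *[of \<epsilon> i j] that by (simp add: sums_iff)
    qed (use d in auto)
  qed
  show "(X has_vector_derivative Xn 1) (at 0)"
    unfolding has_vector_derivative_def
  proof (rule has_derivative_componentwise_within[THEN iffD2, rule_format])
    fix e :: "real^'n^'m" assume "e \<in> Basis"
    then obtain i j where e: "e = axis i (axis j 1)" by (auto simp: Basis_vec_def)
    show "((\<lambda>x. X x \<bullet> e) has_derivative (\<lambda>x. x *\<^sub>R Xn 1 \<bullet> e)) (at 0)"
      using D[of i j] by (simp add: e inner_axis has_field_derivative_def mult_commute_abs)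
  qed
qed

section \<open>Minimizers of the perturbed functional\<close>

lemma J_uniformly_close:
  fixes A0 B0 :: "real^'n::finite^'n"
  assumes "\<delta> > 0"
  shows "\<forall>\<^sub>F p in nhds (A0, B0). \<forall>P\<in>Gr m. \<bar>J (fst p) (snd p) P - J A0 B0 P\<bar> < \<delta>"
proof -
  \<comment> \<open>The radius 1 is arbitrary: it makes the parameter range compact, so that uniform
    continuity on the product gives a bound independent of \<open>P\<close>.\<close>
  let ?K = "cball (A0, B0) 1 \<times> (Gr m :: (real^'n^'n) set)"
  have "uniformly_continuous_on ?K (\<lambda>(p, P). J (fst p) (snd p) P)"
    unfolding J_def case_prod_beta
    by (intro compact_uniformly_continuous continuous_intros compact_Times compact_cball compact_Gr)
  from this[unfolded uniformly_continuous_on_def, rule_format, OF assms]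
  obtain d where d: "d > 0" and
    u: "\<forall>q\<in>?K. \<forall>q'\<in>?K. dist q' q < d \<longrightarrow>
      dist ((\<lambda>(p, P). J (fst p) (snd p) P) q') ((\<lambda>(p, P). J (fst p) (snd p) P) q) < \<delta>"
    by blast
  have "\<bar>J (fst p) (snd p) P - J A0 B0 P\<bar> < \<delta>"
    if p: "dist p (A0, B0) < min d 1" and P: "P \<in> Gr m" for p P
  proof -
    have "((A0, B0), P) \<in> ?K" "(p, P) \<in> ?K" "dist (p, P) ((A0, B0), P) < d"
      using p P by (auto simp: dist_commute dist_prod_def)
    from u[rule_format, OF this] show ?thesis
      by (simp add: dist_real_def)
  qed
  then show ?thesis
    unfolding eventually_nhds_metric using d by (intro exI[of _ "min d 1"]) auto
qed

lemma J_minimizer_exists: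
  fixes A B :: "real^'n::finite^'n"
  assumes "(Gr m :: (real^'n^'n) set) \<noteq> {}"
  obtains P where "is_arg_min (J A B) (\<lambda>Q. Q \<in> Gr m) P"
proof -
  have "continuous_on (Gr m) (J A B)"
    unfolding J_def[abs_def] by (intro continuous_intros)
  from continuous_attains_inf[OF compact_Gr assms this] show thesis
    using that by (auto simp: is_arg_min_def not_less)
qed

lemma commutator_eq_derivative:
  fixes A B P :: "real \<Rightarrow> real^'n::finite^'n"
  assumes A: "(A has_vector_derivative A1) (at 0)" "A 0 = diagonal a"
    and B: "(B has_vector_derivative B1) (at 0)" "B 0 = diagonal b"
    and P: "(P has_vector_derivative P1) (at 0)" "P 0 = proj S"
    and eq: "\<forall>\<^sub>F \<epsilon> in nhds 0. commutator_eq (A \<epsilon>) (B \<epsilon>) (P \<epsilon>) = 0"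
    and i: "i \<in> S" and j: "j \<notin> S"
  shows "(b j - b i + a i * (a i - a j)) * P1 $ i $ j = - (B1 $ i $ j - a i * A1 $ i $ j)"
proof -
  have "((\<lambda>\<epsilon>. commutator_eq (A \<epsilon>) (B \<epsilon>) (P \<epsilon>)) has_vector_derivative
      ((B 0 - A 0 ** P 0 ** A 0) ** P1 + (B1 - (A 0 ** P 0 ** A1 + (A 0 ** P1 + A1 ** P 0) ** A 0)) ** P 0
      - (P 0 ** (B1 - (A 0 ** P 0 ** A1 + (A 0 ** P1 + A1 ** P 0) ** A 0)) + P1 ** (B 0 - A 0 ** P 0 ** A 0)))) (at 0)"
    (is "(_ has_vector_derivative ?D) _")
    unfolding commutator_eq_def
    by (intro has_vector_derivative_matrix_mult has_vector_derivative_diff A(1) B(1) P(1))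
  moreover have "((\<lambda>\<epsilon>. commutator_eq (A \<epsilon>) (B \<epsilon>) (P \<epsilon>)) has_vector_derivative 0) (at 0)"
  proof -
    from eq obtain U where U: "open U" "0 \<in> U" "\<And>\<epsilon>. \<epsilon> \<in> U \<Longrightarrow> commutator_eq (A \<epsilon>) (B \<epsilon>) (P \<epsilon>) = 0"
      unfolding eventually_nhds by blast
    have "((\<lambda>\<epsilon>. 0 :: real^'n^'n) has_vector_derivative 0) (at 0)"
      by simp
    then show ?thesis
      by (rule has_vector_derivative_transform_within_open[OF _ U(1,2)]) (simp add: U(3))
  qed
  ultimately have "?D = 0"
    by (rule vector_derivative_unique_at)
  then have "?D $ i $ j = 0" by simp
  moreover have "B 0 - A 0 ** P 0 ** A 0 = diagonal (\<lambda>i. b i - (if i \<in> S then (a i)\<^sup>2 else 0))"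
    by (simp add: A B P vec_eq_iff diagonal_mult_nth mult_diagonal_nth diagonal_nth mult_proj_nth power2_eq_square)
  \<comment> \<open>Only this term brings in \<open>A1\<close>: its mirror image
    \<open>A1 ** P 0 ** A 0\<close> has zero column \<open>j\<close> because
    \<open>j \<notin> S\<close>. Hence the formula contains \<open>a i\<close> but not
    \<open>a j\<close> next to \<open>A1\<close>.\<close>
  moreover have "(A 0 ** P 0 ** A1) $ i $ j = a i * A1 $ i $ j"
    using i by (simp add: A P diagonal_mult_nth proj_mult_nth flip: matrix_mul_assoc)
  ultimately have "(b i - (a i)\<^sup>2) * P1 $ i $ j
      - ((B1 $ i $ j - (a i * A1 $ i $ j + a i * P1 $ i $ j * a j)) + P1 $ i $ j * b j) = 0"
    using i j unfolding A(2) P(2)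
    by (simp add: diagonal_mult_nth mult_diagonal_nth mult_proj_nth proj_mult_nth)
  then show ?thesis
    by (simp add: power2_eq_square algebra_simps)
qed

text \<open>Differentiating P P = P gives P0 P1 + P1 P0 = P1, which reads 2 X = X on the block
  inside \<open>S\<close> and 0 = X on the block outside.\<close>

lemma projector_derivative:
  fixes P :: "real \<Rightarrow> real^'n::finite^'n"
  assumes P: "(P has_vector_derivative P1) (at 0)" "P 0 = proj S"
    and eq: "\<forall>\<^sub>F \<epsilon> in nhds 0. P \<epsilon> \<in> Gr m"
  shows "i \<in> S \<longleftrightarrow> j \<in> S \<Longrightarrow> P1 $ i $ j = 0" "P1 $ i $ j = P1 $ j $ i"
proof -
  from eq obtain U where U: "open U" "0 \<in> U" "\<And>\<epsilon>. \<epsilon> \<in> U \<Longrightarrow> P \<epsilon> \<in> Gr m"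
    unfolding eventually_nhds by blast
  have "((\<lambda>\<epsilon>. P \<epsilon> ** P \<epsilon>) has_vector_derivative (P 0 ** P1 + P1 ** P 0)) (at 0)"
    by (intro has_vector_derivative_matrix_mult P(1))
  then have "(P has_vector_derivative (P 0 ** P1 + P1 ** P 0)) (at 0)"
    by (rule has_vector_derivative_transform_within_open[OF _ U(1,2)]) (simp add: GrD(2)[OF U(3)])
  then have "P 0 ** P1 + P1 ** P 0 = P1"
    using P(1) by (rule vector_derivative_unique_at)
  then have "(P 0 ** P1 + P1 ** P 0) $ i $ j = P1 $ i $ j" by simp
  then show "P1 $ i $ j = 0" if "i \<in> S \<longleftrightarrow> j \<in> S"
    using that by (auto simp: P(2) proj_mult_nth mult_proj_nth split: if_splits)
  have "bounded_linear (\<lambda>X :: real^'n^'n. X $ i $ j)" for i j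
    by (intro bounded_linear_compose[OF bounded_linear_vec_nth] bounded_linear_vec_nth)
  note d = bounded_linear.has_vector_derivative[OF this P(1)]
  have "((\<lambda>\<epsilon>. P \<epsilon> $ j $ i) has_vector_derivative P1 $ i $ j) (at 0)"
    by (rule has_vector_derivative_transform_within_open[OF d[of i j] U(1,2)])
      (rule sym_mat_nth[OF GrD(1)[OF U(3)]])
  from vector_derivative_unique_at[OF this d[of j i]]
  show "P1 $ i $ j = P1 $ j $ i" .
qed

lemma eventually_nhds_0_real: "(\<forall>\<^sub>F x in nhds (0::real). Q x) \<longleftrightarrow> (\<exists>d>0. \<forall>x. \<bar>x\<bar> < d \<longrightarrow> Q x)"
  by (simp add: eventually_nhds_metric dist_norm)

lemma matrix_holomorphic_on_tendsto:
  assumes "matrix_holomorphic_on S X" "open S" "z \<in> S"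
  shows "(X \<longlongrightarrow> X z) (nhds z)"
proof (intro vec_tendstoI)
  fix i j
  have "continuous_on S (\<lambda>z. X z $ i $ j)"
    using assms(1) by (auto simp: matrix_holomorphic_on_def intro: holomorphic_on_imp_continuous_on)
  then show "((\<lambda>x. X x $ i $ j) \<longlongrightarrow> X z $ i $ j) (nhds z)"
    using assms(2,3) by (metis continuous_on_eq_continuous_at isContD tendsto_at_iff_tendsto_nhds)
qed

lemma minimizer_expansion_diagonal:
  fixes A B :: "real \<Rightarrow> real^'n::finite^'n" and a b :: "'n \<Rightarrow> real"
  assumes N: "open N" "0 \<in> N"
    and sym: "\<And>\<epsilon>. \<epsilon> \<in> N \<Longrightarrow> sym_mat (A \<epsilon>)" "\<And>\<epsilon>. \<epsilon> \<in> N \<Longrightarrow> sym_mat (B \<epsilon>)"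
    and series: "\<forall>\<^sub>F \<epsilon> in nhds 0. (\<lambda>n. \<epsilon> ^ n *\<^sub>R An n) sums A \<epsilon>"
      "\<forall>\<^sub>F \<epsilon> in nhds 0. (\<lambda>n. \<epsilon> ^ n *\<^sub>R Bn n) sums B \<epsilon>"
    and init: "An 0 = diagonal a" "Bn 0 = diagonal b"
    and occ: "\<And>i. i \<in> S \<Longrightarrow> b i - 1/2 * (a i)\<^sup>2 \<le> \<mu>"
    and virt: "\<And>i. i \<notin> S \<Longrightarrow> \<nu> \<le> b i - 1/2 * (a i)\<^sup>2"
    and gap: "\<mu> < \<nu>"
  obtains \<epsilon>\<^sub>0 P Pn where "\<epsilon>\<^sub>0 > 0" "{-\<epsilon>\<^sub>0<..<\<epsilon>\<^sub>0} \<subseteq> N"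
    "\<And>\<epsilon> Q. \<epsilon> \<in> {-\<epsilon>\<^sub>0<..<\<epsilon>\<^sub>0} \<Longrightarrow> is_arg_min (J (A \<epsilon>) (B \<epsilon>)) (\<lambda>Q. Q \<in> Gr (card S)) Q \<longleftrightarrow> Q = P \<epsilon>"
    "real_analytic_on {-\<epsilon>\<^sub>0<..<\<epsilon>\<^sub>0} P"
    "\<forall>\<^sub>F \<epsilon> in nhds 0. (\<lambda>n. \<epsilon> ^ n *\<^sub>R Pn n) sums P \<epsilon>"
    "Pn 0 = proj S"
    "\<And>i j. i \<in> S \<longleftrightarrow> j \<in> S \<Longrightarrow> Pn 1 $ i $ j = 0"
    "\<And>i j. Pn 1 $ i $ j = Pn 1 $ j $ i"
    "\<And>i j. i \<in> S \<Longrightarrow> j \<notin> S \<Longrightarrow>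
      Pn 1 $ i $ j = - (Bn 1 $ i $ j - a i * An 1 $ i $ j) / (b j - b i + a i * (a i - a j))"
proof -
  \<comment> \<open>Completing the square turns the denominator into a difference of the
    \<open>c\<close> values plus a nonnegative term, so it is at least
    \<open>\<nu> - \<mu>\<close>.\<close>
  have denom: "b j - b i + a i * (a i - a j) > 0" if "i \<in> S" "j \<notin> S" for i j
  proof -
    have "b j - b i + a i * (a i - a j) =
        (b j - 1/2 * (a j)\<^sup>2) - (b i - 1/2 * (a i)\<^sup>2) + 1/2 * (a i - a j)\<^sup>2"
      by (simp add: power2_eq_square field_simps)
    moreover have "\<dots> \<ge> \<nu> - \<mu> + 0"
      using occ[OF that(1)] virt[OF that(2)] by (intro add_mono) auto
    ultimately show ?thesis using gap by linarith
  qed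
  note A = power_series_derivative_0[OF series(1)] and B = power_series_derivative_0[OF series(2)]
  have A0: "A 0 = diagonal a" and B0: "B 0 = diagonal b"
    using A(1) B(1) init by simp_all
  define \<alpha> \<beta> where "\<alpha> i = complex_of_real (a i)" and "\<beta> i = complex_of_real (b i)" for i
  \<comment> \<open>\<open>\<alpha>\<close> and \<open>\<beta>\<close> stay frozen at the
    unperturbed values; only the pair \<open>p\<close> follows the perturbation.\<close>
  define T where "T p = update S \<alpha> \<beta> (fst p) (snd p)" for p
  have ne: "\<beta> j - \<beta> i + \<alpha> i * (\<alpha> i - \<alpha> j) \<noteq> 0" if "i \<in> S" "j \<notin> S" for i j
    using denom[OF that] unfolding \<alpha>_def \<beta>_def
    by (metis of_real_add of_real_diff of_real_eq_0_iff of_real_mult less_irrefl)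
  obtain r where r: "r > 0" and contr: "\<forall>\<^sub>F p in nhds (diagonal \<alpha>, diagonal \<beta>).
      (\<forall>x\<in>cball 0 r. \<forall>y\<in>cball 0 r. norm (T p x - T p y) \<le> 1/2 * norm (x - y)) \<and> norm (T p 0) \<le> r/2"
  proof (rule contraction_near_critical_fixpoint)
    show "(T p has_derivative update_deriv S \<alpha> \<beta> (fst p) (snd p) x) (at x)" for p x
      unfolding T_def by (rule has_derivative_update)
    show "continuous_on UNIV (\<lambda>(p, x). update_deriv S \<alpha> \<beta> (fst p) (snd p) x h)" for h
      by (rule continuous_on_update_deriv)
    show "update_deriv S \<alpha> \<beta> (fst (diagonal \<alpha>, diagonal \<beta>)) (snd (diagonal \<alpha>, diagonal \<beta>)) 0 h = 0" for h
      using ne by (simp add: update_deriv_diagonal)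
    show "T (diagonal \<alpha>, diagonal \<beta>) 0 = 0"
      by (simp add: T_def update_diagonal)
    show "continuous_on UNIV (\<lambda>p. T p 0)"
      unfolding T_def by (rule continuous_on_update)
  qed
  obtain AC \<rho>1 where \<rho>1: "\<rho>1 > 0" and AC_hol: "matrix_holomorphic_on (ball 0 \<rho>1) AC"
    and AC: "\<And>\<epsilon>. \<bar>\<epsilon>\<bar> < \<rho>1 \<Longrightarrow> AC (complex_of_real \<epsilon>) = cmat (A \<epsilon>)"
    using matrix_power_series_extension[OF series(1)] by blast
  obtain BC \<rho>2 where \<rho>2: "\<rho>2 > 0" and BC_hol: "matrix_holomorphic_on (ball 0 \<rho>2) BC"
    and BC: "\<And>\<epsilon>. \<bar>\<epsilon>\<bar> < \<rho>2 \<Longrightarrow> BC (complex_of_real \<epsilon>) = cmat (B \<epsilon>)"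
    using matrix_power_series_extension[OF series(2)] by blast
  have AC0: "AC 0 = diagonal \<alpha>" and BC0: "BC 0 = diagonal \<beta>"
    using AC[of 0] BC[of 0] \<rho>1 \<rho>2 A0 B0 by (simp_all add: cmat_diagonal \<alpha>_def[abs_def] \<beta>_def[abs_def])
  have lim: "((\<lambda>z. (AC z, BC z)) \<longlongrightarrow> (diagonal \<alpha>, diagonal \<beta>)) (nhds 0)"
    unfolding AC0[symmetric] BC0[symmetric]
    using \<rho>1 \<rho>2 by (intro tendsto_Pair matrix_holomorphic_on_tendsto[OF AC_hol] matrix_holomorphic_on_tendsto[OF BC_hol]) auto
  have "\<forall>\<^sub>F z in nhds 0. (\<forall>x\<in>cball 0 r. \<forall>y\<in>cball 0 r.
      norm (T (AC z, BC z) x - T (AC z, BC z) y) \<le> 1/2 * norm (x - y)) \<and> norm (T (AC z, BC z) 0) \<le> r/2"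
    by (rule eventually_compose_filterlim[OF contr lim])
  then obtain \<rho>3 where \<rho>3: "\<rho>3 > 0" and contr: "\<And>z x y. norm z < \<rho>3 \<Longrightarrow> x \<in> cball 0 r \<Longrightarrow> y \<in> cball 0 r \<Longrightarrow>
      norm (T (AC z, BC z) x - T (AC z, BC z) y) \<le> 1/2 * norm (x - y)"
    and small: "\<And>z. norm z < \<rho>3 \<Longrightarrow> norm (T (AC z, BC z) 0) \<le> r/2"
    unfolding eventually_nhds_metric by (auto simp: dist_norm)
  define \<rho> where "\<rho> = min \<rho>1 (min \<rho>2 \<rho>3)"
  have \<rho>: "\<rho> > 0" using \<rho>1 \<rho>2 \<rho>3 by (simp add: \<rho>_def)
  have hol: "matrix_holomorphic_on (ball 0 \<rho>) AC" "matrix_holomorphic_on (ball 0 \<rho>) BC"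
    using AC_hol BC_hol unfolding matrix_holomorphic_on_def \<rho>_def
    by (meson holomorphic_on_subset min.cobounded1 min.cobounded2 order_trans subset_ball)+
  obtain f where f: "\<And>z. z \<in> ball 0 \<rho> \<Longrightarrow> f z \<in> cball 0 r"
    "\<And>z. z \<in> ball 0 \<rho> \<Longrightarrow> T (AC z, BC z) (f z) = f z"
    "\<And>z x. z \<in> ball 0 \<rho> \<Longrightarrow> x \<in> cball 0 r \<Longrightarrow> T (AC z, BC z) x = x \<Longrightarrow> x = f z"
    "\<And>i j. (\<lambda>z. f z $ i $ j) holomorphic_on ball 0 \<rho>"
  proof (rule holomorphic_fixpoint[of "ball 0 \<rho>" r "\<lambda>z. T (AC z, BC z)"])
    show "(\<lambda>z. T (AC z, BC z) (g z) $ i $ j) holomorphic_on ball 0 \<rho>"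
      if "\<And>i j. (\<lambda>z. g z $ i $ j) holomorphic_on ball 0 \<rho>" for g i j
      using matrix_holomorphic_on_update[OF hol, of g] that
      by (simp add: T_def matrix_holomorphic_on_def)
  qed (use r contr small in \<open>auto simp: \<rho>_def\<close>)
  \<comment> \<open>Taking real parts gives a real matrix function at once; for small real
    \<epsilon> nothing is lost, since the fixed point turns out to be the complexified
    minimizer.\<close>
  define P where "P \<epsilon> = (\<chi> i j. Re ((proj S + f (complex_of_real \<epsilon>)) $ i $ j))" for \<epsilon>
  have P_analytic: "real_analytic_on {-\<rho><..<\<rho>} P"
    unfolding P_def using f(4)
    by (intro real_analytic_on_Re matrix_holomorphic_intros) (simp add: matrix_holomorphic_on_def)

  let ?P0 = "proj S :: real^'n^'n"
  let ?min = "\<lambda>\<epsilon>. is_arg_min (J (A \<epsilon>) (B \<epsilon>)) (\<lambda>Q. Q \<in> Gr (card S))"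
  have P0: "?P0 \<in> Gr (card S)"
    unfolding proj_def by (rule diagonal_indicator_in_Gr)
  \<comment> \<open>Chosen so that \<open>2 * \<delta>\<close> is the growth bound
    \<open>(\<nu> - \<mu>) / 2 * r\<^sup>2\<close> at distance \<open>r\<close>; the factor 2 pays
    for replacing the perturbed functional by the unperturbed one at both \<open>Q\<close> and
    \<open>?P0\<close>.\<close>
  define \<delta> where "\<delta> = (\<nu> - \<mu>) / 4 * r\<^sup>2"
  have \<delta>: "\<delta> > 0" using gap r by (simp add: \<delta>_def)
  have lim0: "((\<lambda>\<epsilon>. (A \<epsilon>, B \<epsilon>)) \<longlongrightarrow> (A 0, B 0)) (nhds 0)"
    using has_vector_derivative_continuous[OF A(2)] has_vector_derivative_continuous[OF B(2)]
    by (intro tendsto_Pair) (auto simp: continuous_at tendsto_at_iff_tendsto_nhds)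
  have close: "\<forall>\<^sub>F \<epsilon> in nhds 0. \<forall>Q\<in>Gr (card S). \<bar>J (A \<epsilon>) (B \<epsilon>) Q - J (A 0) (B 0) Q\<bar> < \<delta>"
    using eventually_compose_filterlim[OF J_uniformly_close[OF \<delta>] lim0] by simp
  have "\<forall>\<^sub>F \<epsilon> in nhds 0. \<epsilon> \<in> N"
    using N by (rule eventually_nhds_in_open)
  with close obtain d where d: "d > 0" "\<And>\<epsilon>. \<bar>\<epsilon>\<bar> < d \<Longrightarrow> \<epsilon> \<in> N"
    "\<And>\<epsilon> Q. \<bar>\<epsilon>\<bar> < d \<Longrightarrow> Q \<in> Gr (card S) \<Longrightarrow> \<bar>J (A \<epsilon>) (B \<epsilon>) Q - J (A 0) (B 0) Q\<bar> < \<delta>"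
    unfolding eventually_nhds_0_real by (metis (no_types, lifting) min_less_iff_conj)
  define \<epsilon>\<^sub>0 where "\<epsilon>\<^sub>0 = min d \<rho>"
  have \<epsilon>\<^sub>0: "\<epsilon>\<^sub>0 > 0" using d \<rho> by (simp add: \<epsilon>\<^sub>0_def)
  have min_eq: "commutator_eq (A \<epsilon>) (B \<epsilon>) Q = 0" if "\<bar>\<epsilon>\<bar> < \<epsilon>\<^sub>0" "?min \<epsilon> Q" for \<epsilon> Q
    using J_minimizer_stationary[OF that(2) sym] that(1) d(2)[of \<epsilon>]
    by (simp add: commutator_eq_def \<epsilon>\<^sub>0_def)
  \<comment> \<open>Comparison with the competitor \<open>?P0\<close> puts every minimizer within
    \<open>r\<close> of it, where the fixed point is unique.\<close>
  have unique: "Q = P \<epsilon>" if \<epsilon>: "\<bar>\<epsilon>\<bar> < \<epsilon>\<^sub>0" and Q: "?min \<epsilon> Q" for \<epsilon> Q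
  proof -
    have QG: "Q \<in> Gr (card S)" and le: "J (A \<epsilon>) (B \<epsilon>) Q \<le> J (A \<epsilon>) (B \<epsilon>) ?P0"
      using Q P0 by (auto simp: is_arg_min_def not_less)
    have \<epsilon>d: "\<bar>\<epsilon>\<bar> < d" using \<epsilon> by (simp add: \<epsilon>\<^sub>0_def)
    have "(\<nu> - \<mu>) / 2 * (norm (Q - ?P0))\<^sup>2 \<le> J (A 0) (B 0) Q - J (A 0) (B 0) ?P0"
      unfolding A0 B0 proj_def using QG occ virt by (rule J_diagonal_quadratic_growth)
    also have "\<dots> \<le> 2 * \<delta>"
      using d(3)[OF \<epsilon>d QG] d(3)[OF \<epsilon>d P0] le by linarith
    also have "\<dots> = (\<nu> - \<mu>) / 2 * r\<^sup>2"
      by (simp add: \<delta>_def)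
    finally have "(norm (Q - ?P0))\<^sup>2 \<le> r\<^sup>2"
      using gap by (simp add: mult_le_cancel_left_pos)
    then have "norm (Q - ?P0) \<le> r"
      using r by (simp add: power2_le_iff_abs_le)
    then have "cmat Q - proj S \<in> cball 0 r"
      using norm_cmat[of "Q - ?P0"] by (simp add: cmat_hom cmat_proj)
    moreover have "commutator_eq (AC (complex_of_real \<epsilon>)) (BC (complex_of_real \<epsilon>)) (cmat Q) = 0"
    proof -
      have "commutator_eq (cmat (A \<epsilon>)) (cmat (B \<epsilon>)) (cmat Q) = cmat (commutator_eq (A \<epsilon>) (B \<epsilon>) Q)"
        by (simp add: commutator_eq_def cmat_hom cmat_mult)
      also have "\<dots> = 0"
        by (simp add: min_eq[OF \<epsilon> Q] vec_eq_iff)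
      finally show ?thesis
        using \<epsilon> AC BC by (simp add: \<epsilon>\<^sub>0_def \<rho>_def)
    qed
    then have "T (AC (complex_of_real \<epsilon>), BC (complex_of_real \<epsilon>)) (cmat Q - proj S) = cmat Q - proj S"
      unfolding T_def using GrD(2)[OF QG] by (simp add: update_fixpoint flip: cmat_mult)
    ultimately have "cmat Q - proj S = f (complex_of_real \<epsilon>)"
      using \<epsilon> by (intro f(3)) (auto simp: \<epsilon>\<^sub>0_def)
    then have "proj S + f (complex_of_real \<epsilon>) = cmat Q" by (simp add: algebra_simps)
    then show ?thesis
      by (simp add: P_def vec_eq_iff)
  qed
  \<comment> \<open>Some minimizer exists by compactness and must be \<open>P \<epsilon>\<close>;
    this is also how \<open>P \<epsilon>\<close> is seen to be a projector.\<close>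
  have min_P: "?min \<epsilon> (P \<epsilon>)" if "\<bar>\<epsilon>\<bar> < \<epsilon>\<^sub>0" for \<epsilon>
    using J_minimizer_exists[of "card S"] P0 unique[OF that] by (metis empty_iff)
  obtain Pn where Pn: "\<forall>\<^sub>F \<epsilon> in nhds 0. (\<lambda>n. \<epsilon> ^ n *\<^sub>R Pn n) sums P \<epsilon>"
  proof -
    have "0 \<in> {-\<rho><..<\<rho>}" using \<rho> by simp
    then obtain Pn s where "s > 0" "\<And>y. \<bar>y - 0\<bar> < s \<Longrightarrow> (\<lambda>n. (y - 0) ^ n *\<^sub>R Pn n) sums P y"
      using P_analytic unfolding real_analytic_on_def by blast
    then show thesis
      by (intro that[of Pn]) (auto simp: eventually_nhds_0_real)
  qed
  note P = power_series_derivative_0[OF Pn]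
  \<comment> \<open>Quadratic growth at \<epsilon> = 0 makes \<open>?P0\<close> a minimizer, so
    uniqueness identifies the constant term of the series.\<close>
  have init_min: "?min 0 ?P0"
  proof -
    have "J (A 0) (B 0) ?P0 \<le> J (A 0) (B 0) Q" if "Q \<in> Gr (card S)" for Q
    proof -
      have "0 \<le> (\<nu> - \<mu>) / 2 * (norm (Q - ?P0))\<^sup>2"
        using gap by simp
      also have "\<dots> \<le> J (A 0) (B 0) Q - J (A 0) (B 0) ?P0"
        unfolding A0 B0 proj_def using that occ virt by (rule J_diagonal_quadratic_growth)
      finally show ?thesis by simp
    qed
    with P0 show ?thesis by (auto simp: is_arg_min_def not_less)
  qed
  have P_0: "P 0 = ?P0"
    using unique[OF _ init_min] \<epsilon>\<^sub>0 by simp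
  have ev: "\<forall>\<^sub>F \<epsilon> in nhds 0. commutator_eq (A \<epsilon>) (B \<epsilon>) (P \<epsilon>) = 0" "\<forall>\<^sub>F \<epsilon> in nhds 0. P \<epsilon> \<in> Gr (card S)"
    unfolding eventually_nhds_0_real using \<epsilon>\<^sub>0 min_P min_eq by (auto simp: is_arg_min_def)
  show thesis
  proof (rule that[OF \<epsilon>\<^sub>0 _ _ _ Pn])
    show "{-\<epsilon>\<^sub>0<..<\<epsilon>\<^sub>0} \<subseteq> N"
      using d(2) by (auto simp: \<epsilon>\<^sub>0_def abs_less_iff)
    show "?min \<epsilon> Q \<longleftrightarrow> Q = P \<epsilon>" if "\<epsilon> \<in> {-\<epsilon>\<^sub>0<..<\<epsilon>\<^sub>0}" for \<epsilon> Q
      using that unique[of \<epsilon> Q] min_P[of \<epsilon>] by (auto simp: abs_less_iff)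
    show "real_analytic_on {-\<epsilon>\<^sub>0<..<\<epsilon>\<^sub>0} P"
      using P_analytic unfolding real_analytic_on_def \<epsilon>\<^sub>0_def by auto
    show "Pn 0 = proj S"
      using P(1) P_0 by simp
    show "Pn 1 $ i $ j = 0" if "i \<in> S \<longleftrightarrow> j \<in> S" for i j
      using projector_derivative(1)[OF P(2) P_0 ev(2) that] .
    show "Pn 1 $ i $ j = Pn 1 $ j $ i" for i j
      using projector_derivative(2)[OF P(2) P_0 ev(2)] .
    show "Pn 1 $ i $ j = - (Bn 1 $ i $ j - a i * An 1 $ i $ j) / (b j - b i + a i * (a i - a j))"
      if "i \<in> S" "j \<notin> S" for i j
      using commutator_eq_derivative[OF A(2) A0 B(2) B0 P(2) P_0 ev(1) that] denom[OF that]
      by (simp add: field_simps)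
  qed
qed

section \<open>Conjugation by an orthogonal matrix\<close>

lemma bounded_linear_conjugate: "bounded_linear (\<lambda>X. U ** X ** V)"
  for U V :: "real^'n::finite^'n"
  by (rule bounded_linear_compose[OF bounded_bilinear.bounded_linear_left[OF bounded_bilinear_matrix_mult]
        bounded_bilinear.bounded_linear_right[OF bounded_bilinear_matrix_mult]])

lemma real_analytic_on_bounded_linear:
  assumes "bounded_linear L" "real_analytic_on S f"
  shows "real_analytic_on S (\<lambda>x. L (f x))"
  unfolding real_analytic_on_def
proof
  fix x assume "x \<in> S"
  then obtain a r where r: "r > 0" "\<And>y. \<bar>y - x\<bar> < r \<Longrightarrow> (\<lambda>n. (y - x) ^ n *\<^sub>R a n) sums f y"
    using assms(2) unfolding real_analytic_on_def by blast
  have "(\<lambda>n. (y - x) ^ n *\<^sub>R L (a n)) sums L (f y)" if "\<bar>y - x\<bar> < r" for y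
    using bounded_linear.sums[OF assms(1) r(2)[OF that]]
    by (simp add: linear_simps[OF assms(1)])
  with r(1) show "\<exists>a r. r > 0 \<and> (\<forall>y. \<bar>y - x\<bar> < r \<longrightarrow> (\<lambda>n. (y - x) ^ n *\<^sub>R a n) sums L (f y))"
    by (intro exI[of _ "\<lambda>n. L (a n)"] exI[of _ r]) blast
qed

lemma eventually_power_series_bounded_linear:
  assumes "bounded_linear L" "\<forall>\<^sub>F \<epsilon> in F. (\<lambda>n. \<epsilon> ^ n *\<^sub>R Xn n) sums X \<epsilon>"
  shows "\<forall>\<^sub>F \<epsilon> in F. (\<lambda>n. \<epsilon> ^ n *\<^sub>R L (Xn n)) sums L (X \<epsilon>)"
  using assms(2)
proof eventually_elim
  case (elim \<epsilon>)
  show ?case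
    using bounded_linear.sums[OF assms(1) elim] by (simp add: linear_simps[OF assms(1)])
qed

lemma orthogonal_conjugate_cancel:
  assumes "orthogonal_matrix (U :: real^'n::finite^'n)"
  shows "transpose U ** (U ** X ** transpose U) ** U = X"
    "U ** (transpose U ** X ** U) ** transpose U = X"
proof -
  have U: "transpose U ** U = mat 1" "U ** transpose U = mat 1"
    using assms by (simp_all add: orthogonal_matrix_def)
  have "transpose U ** (U ** X ** transpose U) ** U = (transpose U ** U) ** X ** (transpose U ** U)"
    by (simp only: matrix_mul_assoc)
  then show "transpose U ** (U ** X ** transpose U) ** U = X" by (simp add: U)
  have "U ** (transpose U ** X ** U) ** transpose U = (U ** transpose U) ** X ** (U ** transpose U)"
    by (simp only: matrix_mul_assoc)
  then show "U ** (transpose U ** X ** U) ** transpose U = X" by (simp add: U)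
qed

lemma sym_mat_conjugate: "sym_mat X \<Longrightarrow> sym_mat (U ** X ** transpose U)"
  by (simp add: sym_mat_def matrix_transpose_mul matrix_mul_assoc)

lemma Gr_conjugate:
  fixes U Q :: "real^'n::finite^'n"
  assumes U: "orthogonal_matrix U" and Q: "Q \<in> Gr m"
  shows "U ** Q ** transpose U \<in> Gr m"
proof -
  have UU: "transpose U ** U = mat 1"
    using U by (simp add: orthogonal_matrix_def)
  have "(U ** Q ** transpose U) ** (U ** Q ** transpose U) = U ** Q ** (transpose U ** U) ** Q ** transpose U"
    by (simp only: matrix_mul_assoc)
  also have "\<dots> = U ** (Q ** Q) ** transpose U"
    by (simp add: UU matrix_mul_assoc)
  finally have "(U ** Q ** transpose U) ** (U ** Q ** transpose U) = U ** Q ** transpose U"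
    using GrD(2)[OF Q] by simp
  moreover have "trace (U ** Q ** transpose U) = trace Q"
    using trace_mul_sym[of "U ** Q" "transpose U"] by (simp add: matrix_mul_assoc UU)
  ultimately show ?thesis
    using GrD[OF Q] sym_mat_conjugate by (auto simp: Gr_def)
qed

lemma J_conjugate:
  fixes U A B Q :: "real^'n::finite^'n"
  shows "J (transpose U ** A ** U) (transpose U ** B ** U) Q = J A B (U ** Q ** transpose U)"
proof -
  have "trace (transpose U ** B ** U ** Q) = trace (B ** (U ** Q ** transpose U))"
    using trace_mul_sym[of "transpose U" "B ** U ** Q"] by (simp add: matrix_mul_assoc)
  moreover have "trace (transpose U ** A ** U ** Q ** (transpose U ** A ** U) ** Q) =
      trace (A ** (U ** Q ** transpose U) ** A ** (U ** Q ** transpose U))"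
    using trace_mul_sym[of "transpose U" "A ** U ** Q ** transpose U ** A ** U ** Q"]
    by (simp add: matrix_mul_assoc)
  ultimately show ?thesis by (simp add: J_def)
qed

text \<open>Conjugation by an orthogonal matrix permutes \<open>Gr m\<close> and, by cyclicity of
  the trace, carries one functional into the other.\<close>

lemma is_arg_min_J_conjugate:
  fixes U A B Q :: "real^'n::finite^'n"
  assumes U: "orthogonal_matrix U"
  shows "is_arg_min (J A B) (\<lambda>Q. Q \<in> Gr m) Q \<longleftrightarrow>
    is_arg_min (J (transpose U ** A ** U) (transpose U ** B ** U)) (\<lambda>Q. Q \<in> Gr m) (transpose U ** Q ** U)"
proof -
  have U': "orthogonal_matrix (transpose U)"
    using U by simp
  note c = orthogonal_conjugate_cancel[OF U]
  have G: "transpose U ** X ** U \<in> Gr m \<longleftrightarrow> X \<in> Gr m" for X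
  proof
    show "X \<in> Gr m" if "transpose U ** X ** U \<in> Gr m"
      using Gr_conjugate[OF U that] unfolding c .
    show "transpose U ** X ** U \<in> Gr m" if "X \<in> Gr m"
      using Gr_conjugate[OF U' that] unfolding transpose_transpose .
  qed
  have "(\<exists>Y. Y \<in> Gr m \<and> J A B Y < J A B Q) \<longleftrightarrow> (\<exists>X. X \<in> Gr m \<and> J A B (U ** X ** transpose U) < J A B Q)"
    (is "?l \<longleftrightarrow> ?r")
  proof
    assume ?l
    then obtain Y where "Y \<in> Gr m" "J A B Y < J A B Q" by blast
    then show ?r
      by (intro exI[of _ "transpose U ** Y ** U"]) (simp only: G c simp_thms)
  next
    assume ?r
    then show ?l using Gr_conjugate[OF U] by blast
  qed
  then show ?thesis
    unfolding is_arg_min_def J_conjugate c G by (simp only:)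
qed

theorem proposition7:
  fixes M m :: nat
    and pos :: "'n::finite \<Rightarrow> nat"
    and N :: "real set"
    and A B :: "real \<Rightarrow> real ^ 'n ^ 'n"
    and An Bn :: "nat \<Rightarrow> real ^ 'n ^ 'n"
    and U0 C0 :: "real ^ 'n ^ 'n"
    and a b c :: "nat \<Rightarrow> real"
    and A1oo A1ov A1vo A1vv B1oo B1ov B1vo B1vv :: "nat \<Rightarrow> nat \<Rightarrow> real"
  assumes pos: "bij_betw pos (UNIV :: 'n set) {1..M}"
    and m: "1 \<le> m" "m \<le> M - 1"
    and sym0: "sym_mat (An 0)" "sym_mat (Bn 0)"
    and commute: "An 0 ** Bn 0 = Bn 0 ** An 0"
    and psd: "psd_mat (An 0)"
    and nbhd: "open N" "0 \<in> N"
    and sym: "\<And>\<epsilon>. \<epsilon> \<in> N \<Longrightarrow> sym_mat (A \<epsilon>)" "\<And>\<epsilon>. \<epsilon> \<in> N \<Longrightarrow> sym_mat (B \<epsilon>)"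
    and analytic: "real_analytic_on N A" "real_analytic_on N B"
    and series_A: "\<forall>\<^sub>F \<epsilon> in nhds 0. (\<lambda>n. \<epsilon> ^ n *\<^sub>R An n) sums A \<epsilon>"
    and series_B: "\<forall>\<^sub>F \<epsilon> in nhds 0. (\<lambda>n. \<epsilon> ^ n *\<^sub>R Bn n) sums B \<epsilon>"
    and value0: "A 0 = An 0" "B 0 = Bn 0"
    and C0: "C0 = Bn 0 - (1/2) *\<^sub>R (An 0 ** An 0)"
    and c_eigenvalues: "eigenvalues_with_mult M C0 c"
    and c_mono: "\<And>i j. 1 \<le> i \<Longrightarrow> i \<le> j \<Longrightarrow> j \<le> M \<Longrightarrow> c i \<le> c j"
    and U0: "orthogonal_matrix U0"
    and A0_diag: "An 0 = U0 ** diag_mat pos a ** transpose U0"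
    and B0_diag: "Bn 0 = U0 ** diag_mat pos b ** transpose U0"
    and C0_diag: "C0 = U0 ** diag_mat pos c ** transpose U0"
    and c_eq: "\<And>j. j \<in> {1..M} \<Longrightarrow> c j = b j - 1/2 * (a j)\<^sup>2"
    and A1: "An 1 = U0 ** block_mat pos m A1oo A1ov A1vo A1vv ** transpose U0"
    and B1: "Bn 1 = U0 ** block_mat pos m B1oo B1ov B1vo B1vv ** transpose U0"
    and gap: "c m < c (m + 1)"
  shows "\<exists>\<epsilon>\<^sub>0 > 0. \<exists>P :: real \<Rightarrow> real ^ 'n ^ 'n.
      {-\<epsilon>\<^sub>0<..<\<epsilon>\<^sub>0} \<subseteq> N
    \<and> (\<forall>\<epsilon> \<in> {-\<epsilon>\<^sub>0<..<\<epsilon>\<^sub>0}. \<forall>Q. is_arg_min (J (A \<epsilon>) (B \<epsilon>)) (\<lambda>Q. Q \<in> Gr m) Q \<longleftrightarrow> Q = P \<epsilon>)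
    \<and> real_analytic_on {-\<epsilon>\<^sub>0<..<\<epsilon>\<^sub>0} P
    \<and> (\<exists>Pn :: nat \<Rightarrow> real ^ 'n ^ 'n. \<exists>P1ov P1vo :: nat \<Rightarrow> nat \<Rightarrow> real.
          (\<forall>\<^sub>F \<epsilon> in nhds 0. (\<lambda>n. \<epsilon> ^ n *\<^sub>R Pn n) sums P \<epsilon>)
        \<and> Pn 0 = U0 ** block_mat pos m (\<lambda>i j. if i = j then 1 else 0) (\<lambda>_ _. 0) (\<lambda>_ _. 0) (\<lambda>_ _. 0)
                    ** transpose U0
        \<and> Pn 1 = U0 ** block_mat pos m (\<lambda>_ _. 0) P1ov P1vo (\<lambda>_ _. 0) ** transpose U0
        \<and> (\<forall>i \<in> {1..m}. \<forall>j \<in> {1..M - m}. P1vo j i = P1ov i j)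
        \<and> (\<forall>i \<in> {1..m}. \<forall>j \<in> {1..M - m}.
              P1ov i j = - (B1ov i j - a i * A1ov i j)
                         / (c (m + j) - c i + 1/2 * (a (m + j) - a i)\<^sup>2)))"
proof -
  \<comment> \<open>The occupied indices. Since \<open>1 \<le> m\<close>, the truncated bound
    \<open>m \<le> M - 1\<close> really means \<open>m < M\<close>, so all of 1 to \<open>m\<close>
    are attained by \<open>pos\<close> and \<open>S\<close> has \<open>m\<close> elements.\<close>
  define S where "S = {p. pos p \<le> m}"
  have inj: "inj pos" and rng: "range pos = {1..M}"
    using pos by (auto simp: bij_betw_def)
  have posM: "pos p \<in> {1..M}" for p
    using rng by auto
  have "pos ` S = {1..m}"
  proof
    show "{1..m} \<subseteq> pos ` S"
    proof
      fix k assume k: "k \<in> {1..m}"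
      then have "k \<in> range pos" using m rng by auto
      then show "k \<in> pos ` S" using k by (auto simp: S_def)
    qed
  qed (use posM in \<open>auto simp: S_def\<close>)
  then have cardS: "card S = m"
    using card_image[of pos S] inj by (simp add: inj_on_def)
  \<comment> \<open>A name for the transpose, so that conjugation by \<open>transpose U0\<close>
    fits the pattern of \<open>sym_mat_conjugate\<close>.\<close>
  define V where "V = transpose U0"
  have VU: "transpose V = U0"
    by (simp add: V_def)
  let ?L = "\<lambda>X. transpose U0 ** X ** U0" and ?K = "\<lambda>X. U0 ** X ** transpose U0"
  note cancel = orthogonal_conjugate_cancel[OF U0]
  have diag: "diag_mat pos d = diagonal (\<lambda>p. d (pos p))" for d
    by (simp add: diag_mat_def diagonal_def)
  have c_ab: "b (pos p) - 1/2 * (a (pos p))\<^sup>2 = c (pos p)" for p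
    using c_eq[OF posM[of p]] by simp
  obtain \<epsilon>\<^sub>0 P Pn where \<epsilon>\<^sub>0: "\<epsilon>\<^sub>0 > 0" "{-\<epsilon>\<^sub>0<..<\<epsilon>\<^sub>0} \<subseteq> N"
    and min: "\<And>\<epsilon> Q. \<epsilon> \<in> {-\<epsilon>\<^sub>0<..<\<epsilon>\<^sub>0} \<Longrightarrow>
      is_arg_min (J (?L (A \<epsilon>)) (?L (B \<epsilon>))) (\<lambda>Q. Q \<in> Gr (card S)) Q \<longleftrightarrow> Q = P \<epsilon>"
    and P: "real_analytic_on {-\<epsilon>\<^sub>0<..<\<epsilon>\<^sub>0} P" "\<forall>\<^sub>F \<epsilon> in nhds 0. (\<lambda>n. \<epsilon> ^ n *\<^sub>R Pn n) sums P \<epsilon>"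
    and Pn0: "Pn 0 = proj S"
    and Pn1_block: "\<And>p q. p \<in> S \<longleftrightarrow> q \<in> S \<Longrightarrow> Pn 1 $ p $ q = 0"
    and Pn1_sym: "\<And>p q. Pn 1 $ p $ q = Pn 1 $ q $ p"
    and Pn1: "\<And>p q. p \<in> S \<Longrightarrow> q \<notin> S \<Longrightarrow>
      Pn 1 $ p $ q = - (?L (Bn 1) $ p $ q - a (pos p) * ?L (An 1) $ p $ q)
        / (b (pos q) - b (pos p) + a (pos p) * (a (pos p) - a (pos q)))"
  proof (rule minimizer_expansion_diagonal[where A = "\<lambda>\<epsilon>. ?L (A \<epsilon>)" and B = "\<lambda>\<epsilon>. ?L (B \<epsilon>)" and An = "\<lambda>n. ?L (An n)"
        and Bn = "\<lambda>n. ?L (Bn n)" and a = "\<lambda>p. a (pos p)" and b = "\<lambda>p. b (pos p)" and S = S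
        and \<mu> = "c m" and \<nu> = "c (m + 1)", OF nbhd])
    show "sym_mat (?L (A \<epsilon>))" "sym_mat (?L (B \<epsilon>))" if "\<epsilon> \<in> N" for \<epsilon>
      using sym_mat_conjugate[OF sym(1)[OF that], of V] sym_mat_conjugate[OF sym(2)[OF that], of V]
      by (simp_all add: VU) (simp_all add: V_def)
    show "\<forall>\<^sub>F \<epsilon> in nhds 0. (\<lambda>n. \<epsilon> ^ n *\<^sub>R ?L (An n)) sums ?L (A \<epsilon>)"
      "\<forall>\<^sub>F \<epsilon> in nhds 0. (\<lambda>n. \<epsilon> ^ n *\<^sub>R ?L (Bn n)) sums ?L (B \<epsilon>)"
      by (rule eventually_power_series_bounded_linear[OF bounded_linear_conjugate], fact)+
    show "?L (An 0) = diagonal (\<lambda>p. a (pos p))" "?L (Bn 0) = diagonal (\<lambda>p. b (pos p))"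
      by (simp_all only: A0_diag B0_diag cancel diag)
    show "b (pos p) - 1/2 * (a (pos p))\<^sup>2 \<le> c m" if "p \<in> S" for p
      unfolding c_ab using that posM[of p] m by (intro c_mono) (auto simp: S_def)
    show "c (m + 1) \<le> b (pos p) - 1/2 * (a (pos p))\<^sup>2" if "p \<notin> S" for p
      unfolding c_ab using that posM[of p] by (intro c_mono) (auto simp: S_def)
  qed (use gap in blast)+
  define num where "num = inv pos"
  have num_pos: "num (pos p) = p" for p
    by (simp add: num_def inj)
  have pos_num: "pos (num k) = k" if "k \<in> {1..M}" for k
    unfolding num_def using that rng by (intro f_inv_into_f) auto
  \<comment> \<open>Columns of the upper right block are numbered from 1, so column \<open>j\<close>
    sits at position \<open>m + j\<close>.\<close>
  define P1ov where "P1ov i j = Pn 1 $ num i $ num (m + j)" for i j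
  show ?thesis
  proof (intro exI conjI ballI allI)
    show "\<epsilon>\<^sub>0 > 0" "{-\<epsilon>\<^sub>0<..<\<epsilon>\<^sub>0} \<subseteq> N" by fact+
    show "is_arg_min (J (A \<epsilon>) (B \<epsilon>)) (\<lambda>Q. Q \<in> Gr m) Q \<longleftrightarrow> Q = ?K (P \<epsilon>)"
      if "\<epsilon> \<in> {-\<epsilon>\<^sub>0<..<\<epsilon>\<^sub>0}" for \<epsilon> Q
    proof -
      have "?L Q = P \<epsilon> \<longleftrightarrow> Q = ?K (P \<epsilon>)"
        using cancel(1)[of "P \<epsilon>"] cancel(2)[of Q] by auto
      then show ?thesis
        using min[OF that, of "?L Q"] unfolding is_arg_min_J_conjugate[OF U0, of "A \<epsilon>"] cardS by simp
    qed
    show "real_analytic_on {-\<epsilon>\<^sub>0<..<\<epsilon>\<^sub>0} (\<lambda>\<epsilon>. ?K (P \<epsilon>))"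
      by (rule real_analytic_on_bounded_linear[OF bounded_linear_conjugate P(1)])
    show "\<forall>\<^sub>F \<epsilon> in nhds 0. (\<lambda>n. \<epsilon> ^ n *\<^sub>R ?K (Pn n)) sums ?K (P \<epsilon>)"
      by (rule eventually_power_series_bounded_linear[OF bounded_linear_conjugate P(2)])
    have "Pn 0 = block_mat pos m (\<lambda>i j. if i = j then 1 else 0) (\<lambda>_ _. 0) (\<lambda>_ _. 0) (\<lambda>_ _. 0)"
      using inj by (auto simp: Pn0 block_mat_def vec_eq_iff proj_nth S_def inj_eq)
    then show "?K (Pn 0) = ?K (block_mat pos m (\<lambda>i j. if i = j then 1 else 0) (\<lambda>_ _. 0) (\<lambda>_ _. 0) (\<lambda>_ _. 0))"
      by simp
    have "Pn 1 = block_mat pos m (\<lambda>_ _. 0) P1ov (\<lambda>j i. P1ov i j) (\<lambda>_ _. 0)"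
      using Pn1_block unfolding vec_eq_iff
      by (auto simp: block_mat_def P1ov_def num_pos S_def Pn1_sym simp del: One_nat_def)
    then show "?K (Pn 1) = ?K (block_mat pos m (\<lambda>_ _. 0) P1ov (\<lambda>j i. P1ov i j) (\<lambda>_ _. 0))"
      by (rule arg_cong)
    \<comment> \<open>The symmetry of the blocks is trivial here because the lower left block was
      instantiated as the transpose; \<open>Pn1_sym\<close> justified that choice above.\<close>
    show "P1ov i j = P1ov i j" for i j ..
    show "P1ov i j = - (B1ov i j - a i * A1ov i j) / (c (m + j) - c i + 1/2 * (a (m + j) - a i)\<^sup>2)"
      if i: "i \<in> {1..m}" and j: "j \<in> {1..M - m}" for i j
    proof -
      have iM: "i \<in> {1..M}" and jM: "m + j \<in> {1..M}"
        using i j m by auto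
      note p = pos_num[OF iM] pos_num[OF jM]
      have S: "num i \<in> S" "num (m + j) \<notin> S"
        using i j by (simp_all add: S_def p)
      have "c (m + j) - c i + 1/2 * (a (m + j) - a i)\<^sup>2 = b (m + j) - b i + a i * (a i - a (m + j))"
        unfolding c_eq[OF iM] c_eq[OF jM] by (simp add: power2_eq_square field_simps)
      moreover have "?L (An 1) $ num i $ num (m + j) = A1ov i j" "?L (Bn 1) $ num i $ num (m + j) = B1ov i j"
        unfolding A1 B1 cancel using i j by (simp_all add: block_mat_def p)
      ultimately show ?thesis
        unfolding P1ov_def Pn1[OF S] p by simp
    qed
  qed
qed

end
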